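(* Let $\varphi$ satisfy (i)–(vi) of the context, let $\Omega\subset\mathbb{R}^n$ be a domain, and for $h=1,\dots,n$ let $\mathscr{A}^h(x)=\{a^h_{ij}(x)\}_{i,j=1}^m$ be an $m\times m$ matrix with complex-valued entries in $L^1_{\rm loc}(\Omega)$. Then the operator $Au=\sum_{h=1}^n\partial_h(\mathscr{A}^h(x)\partial_h u)$ is $L^\Phi$-dissipative if and only if $$\mathrm{Re}\langle \mathscr{A}^h(x)\lambda,\lambda\rangle-\Lambda_\infty^2\,\mathrm{Re}\langle \mathscr{A}^h(x)\omega,\omega\rangle(\mathrm{Re}\langle\lambda,\omega\rangle)^2+\Lambda_\infty\,\mathrm{Re}\big(\langle \mathscr{A}^h(x)\omega,\lambda\rangle-\langle \mathscr{A}^h(x)\lambda,\omega\rangle\big)\mathrm{Re}\langle\lambda,\omega\rangle\ \geq\ 0$$ for almost every $x\in\Omega$, for all $\lambda,\omega\in\mathbb{C}^m$ with $|\omega|=1$, and for every $h=1,\dots,n$ (no summation over $h$).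
   Context: Conditions on $\varphi:(0,+\infty)\to(0,+\infty)$: (i) $\varphi\in C^1((0,+\infty))$; (ii) $(s\varphi(s))'>0$ for all $s>0$; (iii) the range of $s\mapsto s\varphi(s)$ is $(0,+\infty)$; (iv) there are $s_0>0$, $C_1,C_2>0$ and a real $r>-1$ with $C_1s^r\le(s\varphi(s))'\le C_2s^r$ for $s\in(0,s_0)$, and if $r=0$ moreover the finite limit $\lim_{s\to0^+}\varphi(s)>0$ exists and $\lim_{s\to0^+}s\varphi'(s)=0$; (v) there is $s_1>s_0$ such that either $\varphi'(s)\ge0$ for all $s\ge s_1$ or $\varphi'(s)\le0$ for all $s\ge s_1$; (vi) $s\mapsto|s\varphi'(s)/\varphi(s)|$ is non-decreasing on $(0,+\infty)$. The function $\Lambda$ on $(0,+\infty)$ is defined by $\Lambda(s\sqrt{\varphi(s)})=-\dfrac{s\varphi'(s)}{s\varphi'(s)+2\varphi(s)}$, $s>0$. Under (i)–(vi), $\Lambda$ is monotone with constant sign and $\Lambda^2$ is non-decreasing; $\Lambda_\infty:=\lim_{t\to+\infty}\Lambda(t)$. $\langle\cdot,\cdot\rangle$ is the standard Hermitian inner product on $\mathbb{C}^m$, $|\cdot|$ its norm; $C^1_0(\Omega)$ is the space of complex-valued $C^1$ functions with compact support in $\Omega$. The expression $\varphi(|u|)u$ is understood as $0$ where $u=0$. The operator $A$ is $L^\Phi$-dissipative if $\mathrm{Re}\int_\Omega\sum_h\langle\mathscr{A}^h\partial_hu,\partial_h(\varphi(|u|)u)\rangle\,dx\ge0$ for all $u\in[C^1_0(\Omega)]^m$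 such that $\varphi(|u|)u\in[C^1_0(\Omega)]^m$. *)

theory Defs
  imports "HOL-Analysis.Analysis"
begin

definition cdot :: "complex ^ 'm \<Rightarrow> complex ^ 'm \<Rightarrow> complex" where
  "cdot v w = (\<Sum>i\<in>UNIV. v $ i * cnj (w $ i))"

text \<open>The type \<open>complex ^ 'm\<close> carries the norm induced by this inner product.\<close>

lemma cdot_self: "cdot v v = complex_of_real ((norm v)\<^sup>2)"
proof -
  have "(norm v)\<^sup>2 = (\<Sum>i\<in>UNIV. (norm (v $ i))\<^sup>2)"
    by (simp add: norm_vec_def L2_set_def sum_nonneg)
  then show ?thesis
    by (simp only: cdot_def of_real_sum complex_norm_square)
qed

text \<open>The growth condition near \<open>0\<close> and the eventual monotonicity of \<open>\<phi>\<close> share the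
  number \<open>s0\<close>, hence the common existential quantifier. Only the values of \<open>\<phi>\<close> on \<open>{0<..}\<close> matter.\<close>

definition admissible :: "(real \<Rightarrow> real) \<Rightarrow> bool" where
  "admissible \<phi> \<longleftrightarrow>
     (\<forall>s>0. \<phi> s > 0) \<and>
     ((\<forall>s>0. \<phi> differentiable (at s)) \<and> continuous_on {0<..} (deriv \<phi>)) \<and>
     (\<forall>s>0. deriv (\<lambda>s. s * \<phi> s) s > 0) \<and>
     (\<lambda>s. s * \<phi> s) ` {0<..} = {0<..} \<and>
     (\<exists>s0>0.
        (\<exists>C1>0. \<exists>C2>0. \<exists>r>-1.
           (\<forall>s\<in>{0<..<s0}. C1 * s powr r \<le> deriv (\<lambda>s. s * \<phi> s) s \<and>
                           deriv (\<lambda>s. s * \<phi> s) s \<le> C2 * s powr r) \<and>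
           (r = 0 \<longrightarrow> (\<exists>l>0. (\<phi> \<longlongrightarrow> l) (at_right 0)) \<and>
                     ((\<lambda>s. s * deriv \<phi> s) \<longlongrightarrow> 0) (at_right 0))) \<and>
        (\<exists>s1>s0. (\<forall>s\<ge>s1. deriv \<phi> s \<ge> 0) \<or> (\<forall>s\<ge>s1. deriv \<phi> s \<le> 0))) \<and>
     mono_on {0<..} (\<lambda>s. \<bar>s * deriv \<phi> s / \<phi> s\<bar>)"

text \<open>For admissible \<open>\<phi>\<close> the map \<open>s \<mapsto> s * sqrt (\<phi> s)\<close> is injective on \<open>{0<..}\<close>,
  so \<open>\<Lambda>\<close> is obtained through its inverse; see \<open>Lambda_eq\<close>. Moreover \<open>\<Lambda>\<close> is monotone with
  values in \<open>{-1<..<1}\<close>, so that the limit \<open>Lambda_inf\<close> exists and is finite.\<close>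

definition Lambda :: "(real \<Rightarrow> real) \<Rightarrow> real \<Rightarrow> real" where
  "Lambda \<phi> t =
     (let s = inv_into {0<..} (\<lambda>s. s * sqrt (\<phi> s)) t
      in - (s * deriv \<phi> s) / (s * deriv \<phi> s + 2 * \<phi> s))"

definition Lambda_inf :: "(real \<Rightarrow> real) \<Rightarrow> real" where
  "Lambda_inf \<phi> = Lim at_top (Lambda \<phi>)"

lemma inj_on_s_sqrt:
  assumes "admissible \<phi>"
  shows "inj_on (\<lambda>s. s * sqrt (\<phi> s)) {0<..}"
proof (rule strict_mono_on_imp_inj_on, rule strict_mono_onI)
  fix a b :: real
  assume a: "a \<in> {0<..}" and b: "b \<in> {0<..}" and ab: "a < b"
  have pos: "\<phi> s > 0" and diff: "\<phi> differentiable (at s)"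
    and dpos: "deriv (\<lambda>s. s * \<phi> s) s > 0" if "s > 0" for s
    using assms that by (auto simp: admissible_def)
  have "a * \<phi> a < b * \<phi> b"
  proof (rule DERIV_pos_imp_increasing[OF ab])
    fix x assume "a \<le> x" "x \<le> b"
    then have x: "x > 0" using a by simp
    have "(\<lambda>s. s * \<phi> s) differentiable (at x)"
      using diff[OF x] by (intro derivative_intros)
    then have "((\<lambda>s. s * \<phi> s) has_real_derivative deriv (\<lambda>s. s * \<phi> s) x) (at x)"
      by (metis DERIV_deriv_iff_real_differentiable)
    then show "\<exists>y. ((\<lambda>s. s * \<phi> s) has_real_derivative y) (at x) \<and> 0 < y"
      using dpos[OF x] by blast
  qed
  then have "a * (a * \<phi> a) < b * (b * \<phi> b)"
    by (rule mult_strict_mono[OF ab]) (use a b pos[of a] in \<open>auto simp: less_imp_le\<close>)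
  then have "sqrt (a\<^sup>2 * \<phi> a) < sqrt (b\<^sup>2 * \<phi> b)"
    by (simp add: power2_eq_square mult.assoc)
  then show "a * sqrt (\<phi> a) < b * sqrt (\<phi> b)"
    using a b by (simp add: real_sqrt_mult)
qed

lemma Lambda_eq:
  assumes "admissible \<phi>" "s > 0"
  shows "Lambda \<phi> (s * sqrt (\<phi> s)) = - (s * deriv \<phi> s) / (s * deriv \<phi> s + 2 * \<phi> s)"
proof -
  have "inv_into {0<..} (\<lambda>s. s * sqrt (\<phi> s)) (s * sqrt (\<phi> s)) = s"
    using inv_into_f_f[OF inj_on_s_sqrt[OF assms(1)], of s] assms(2) by simp
  then show ?thesis by (simp add: Lambda_def)
qed

definition pderiv_dir :: "'n \<Rightarrow> (real ^ 'n \<Rightarrow> 'b::real_normed_vector) \<Rightarrow> real ^ 'n \<Rightarrow> 'b" where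
  "pderiv_dir h u x = frechet_derivative u (at x) (axis h 1)"

text \<open>\<open>C10 \<Omega>\<close> is the space of vector-valued functions with all components in
  \<open>C\<^sup>1\<^sub>0(\<Omega>)\<close>. Values outside the open set \<open>\<Omega>\<close> are irrelevant.\<close>

definition C10 :: "(real ^ 'n) set \<Rightarrow> (real ^ 'n \<Rightarrow> complex ^ 'm) set" where
  "C10 \<Omega> = {u. (\<forall>x\<in>\<Omega>. u differentiable (at x)) \<and>
               (\<forall>h. continuous_on \<Omega> (pderiv_dir h u)) \<and>
               compact (closure {x\<in>\<Omega>. u x \<noteq> 0}) \<and>
               closure {x\<in>\<Omega>. u x \<noteq> 0} \<subseteq> \<Omega>}"

definition L1_loc :: "(real ^ 'n) set \<Rightarrow> (real ^ 'n \<Rightarrow> complex) \<Rightarrow> bool" where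
  "L1_loc \<Omega> f \<longleftrightarrow> (\<forall>K. compact K \<and> K \<subseteq> \<Omega> \<longrightarrow> set_integrable lebesgue K f)"

text \<open>The operator \<open>\<Sum>h. \<partial>\<^sub>h (A\<^sup>h \<partial>\<^sub>h u)\<close> is given by its coefficients \<open>A h x\<close>. Where \<open>u x = 0\<close>,
  the term \<open>\<phi> (norm (u x)) *\<^sub>R u x\<close> is \<open>0\<close> whatever \<open>\<phi> 0\<close> is.\<close>

definition L_Phi_dissipative ::
    "(real \<Rightarrow> real) \<Rightarrow> (real ^ 'n) set \<Rightarrow> ('n \<Rightarrow> real ^ 'n \<Rightarrow> complex ^ 'm ^ 'm) \<Rightarrow> bool" where
  "L_Phi_dissipative \<phi> \<Omega> A \<longleftrightarrow>
     (\<forall>u. u \<in> C10 \<Omega> \<and> (\<lambda>x. \<phi> (norm (u x)) *\<^sub>R u x) \<in> C10 \<Omega> \<longrightarrow>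
        Re (LINT x:\<Omega>|lebesgue. (\<Sum>h\<in>UNIV.
              cdot (A h x *v pderiv_dir h u x)
                   (pderiv_dir h (\<lambda>y. \<phi> (norm (u y)) *\<^sub>R u y) x))) \<ge> 0)"

end

theory Submission
  imports Defs
begin

text \<open>
  Where \<open>u \<noteq> 0\<close>, the map \<open>v \<mapsto> \<phi>(|v|) v\<close> is differentiable with derivative \<open>dPhi \<phi> v\<close>, so the integrand is
  the sum over \<open>h\<close> of \<open>Re \<langle>A\<^sup>h p, dPhi \<phi> u p\<rangle>\<close> with \<open>p = \<partial>\<^sub>h u\<close>. Writing \<open>u = s \<omega>\<close> and
  \<open>p = l + L Re \<langle>l, \<omega>\<rangle> \<omega>\<close> with \<open>L = \<Lambda>(s sqrt (\<phi> s))\<close> turns this form into \<open>\<phi> s\<close> times the form of the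
  theorem, with \<open>L\<close> in place of \<open>\<Lambda>\<^sub>\<infinity>\<close>.

  Sufficiency: the form of the theorem is concave in \<open>L\<close> and non-negative for \<open>L = 0\<close> and \<open>L = \<Lambda>\<^sub>\<infinity>\<close>,
  hence for all values of \<open>\<Lambda>\<close>, so that the integrand itself is non-negative.

  Necessity: for a fixed vector \<open>v\<close> the test functions
  \<open>u\<^sub>n = \<psi>\<^sup>m v + N\<inverse> \<eta> \<sigma>(N\<^sup>2 x\<^sub>h) p\<close> with \<open>N = n + n\<^sub>0\<close> and \<open>\<sigma> = sin\<close> or \<open>cos\<close>, where the cutoff \<open>\<psi>\<close> is \<open>1\<close> on the
  support of \<open>\<eta>\<close>, stay close to \<open>v\<close> there while their \<open>h\<close>-th derivative grows like \<open>N\<close>. After division by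
  \<open>N\<^sup>2\<close> the contribution of the cutoff disappears, and since \<open>sin\<^sup>2 + cos\<^sup>2 = 1\<close> the integrands of the two
  families add up to \<open>\<eta>\<^sup>2 Re \<langle>A\<^sup>h p, dPhi \<phi> v p\<rangle>\<close> in the limit. Hence this form is non-negative almost
  everywhere for all \<open>v \<noteq> 0\<close> and \<open>p\<close>; finally let \<open>|v| \<rightarrow> \<infinity>\<close>.
\<close>

section \<open>Continuously differentiable functions of several variables\<close>

lemma pderiv_dir_eq:
  "(f has_derivative f') (at x) \<Longrightarrow> pderiv_dir h f x = f' (axis h 1)"
  by (metis frechet_derivative_at pderiv_dir_def)

lemma pderiv_dir_cong_open:
  assumes "open S" "x \<in> S" "\<And>y. y \<in> S \<Longrightarrow> f y = g y" "f differentiable (at x)"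
  shows "g differentiable (at x)" "pderiv_dir h g x = pderiv_dir h f x"
proof -
  from assms(4) obtain f' where f': "(f has_derivative f') (at x)" by (auto simp: differentiable_def)
  then have "(g has_derivative f') (at x)"
    by (rule has_derivative_transform_within_open[OF _ assms(1,2)]) (use assms in auto)
  with f' show "g differentiable (at x)" "pderiv_dir h g x = pderiv_dir h f x"
    by (auto simp: differentiable_def pderiv_dir_eq)
qed

text \<open>The regularity part of \<open>C10\<close> without the support condition and for any
  normed target space, so that scalar cutoffs and vector-valued test functions share the same
  rules.\<close>

definition C1_on :: "(real ^ 'n) set \<Rightarrow> (real ^ 'n \<Rightarrow> 'b::real_normed_vector) \<Rightarrow> bool" where
  "C1_on S f \<longleftrightarrow> (\<forall>x\<in>S. f differentiable (at x)) \<and> (\<forall>h. continuous_on S (pderiv_dir h f))"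

lemma C1_onI:
  assumes "\<And>x. x \<in> S \<Longrightarrow> (f has_derivative f' x) (at x)"
    and "\<And>h. continuous_on S (\<lambda>x. f' x (axis h 1))"
  shows "C1_on S f"
proof -
  have "continuous_on S (pderiv_dir h f)" for h
    by (rule continuous_on_eq[OF assms(2)[of h]]) (use pderiv_dir_eq assms(1) in metis)
  then show ?thesis using assms(1) by (auto simp: C1_on_def differentiable_def)
qed

lemma C1_on_differentiable: "C1_on S f \<Longrightarrow> x \<in> S \<Longrightarrow> f differentiable (at x)"
  by (simp add: C1_on_def)

lemma C1_on_has_derivative:
  "C1_on S f \<Longrightarrow> x \<in> S \<Longrightarrow> (f has_derivative frechet_derivative f (at x)) (at x)"
  using C1_on_differentiable frechet_derivative_works by blast

lemma C1_on_pderiv_dir: "C1_on S f \<Longrightarrow> continuous_on S (pderiv_dir h f)"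
  by (simp add: C1_on_def)

lemma C1_on_continuous: "C1_on S f \<Longrightarrow> continuous_on S f"
  by (meson C1_on_differentiable continuous_at_imp_continuous_on differentiable_imp_continuous_within)

lemma C1_on_subset: "C1_on S f \<Longrightarrow> T \<subseteq> S \<Longrightarrow> C1_on T f"
  by (auto simp: C1_on_def intro: continuous_on_subset)

lemma C1_on_Un: "C1_on S f \<Longrightarrow> C1_on T f \<Longrightarrow> open S \<Longrightarrow> open T \<Longrightarrow> C1_on (S \<union> T) f"
  by (auto simp: C1_on_def intro: continuous_on_open_Un)

lemma C1_on_cong_open:
  assumes "open S" "C1_on S f" "\<And>y. y \<in> S \<Longrightarrow> f y = g y"
  shows "C1_on S g"
proof -
  note * = pderiv_dir_cong_open[OF assms(1) _ assms(3) C1_on_differentiable[OF assms(2)]]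
  have "continuous_on S (pderiv_dir h g)" for h
    by (rule continuous_on_eq[OF C1_on_pderiv_dir[OF assms(2)]]) (simp add: *(2))
  then show ?thesis using * by (simp add: C1_on_def)
qed

lemma C1_on_const: "C1_on S (\<lambda>_. c)"
  by (rule C1_onI[where f' = "\<lambda>_ _. 0"]) auto

lemma C1_on_nth: "C1_on S (\<lambda>x. x $ i)"
  by (rule C1_onI[where f' = "\<lambda>_ v. v $ i"])
    (auto intro!: bounded_linear_imp_has_derivative bounded_linear_vec_nth)

lemma pderiv_dir_nth: "pderiv_dir h (\<lambda>x. x $ i) x = (if i = h then 1 else 0)"
proof -
  have "pderiv_dir h (\<lambda>x. x $ i) x = (axis h (1::real)) $ i"
    by (rule pderiv_dir_eq) (intro bounded_linear_imp_has_derivative bounded_linear_vec_nth)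
  then show ?thesis by (simp add: axis_def)
qed

lemma pderiv_dir_add:
  assumes "f differentiable (at x)" "g differentiable (at x)"
  shows "pderiv_dir h (\<lambda>x. f x + g x) x = pderiv_dir h f x + pderiv_dir h g x"
  using pderiv_dir_eq[OF has_derivative_add[OF assms[unfolded frechet_derivative_works]]]
  by (simp add: pderiv_dir_def)

lemma C1_on_add:
  assumes "C1_on S f" "C1_on S g"
  shows "C1_on S (\<lambda>x. f x + g x)"
  by (rule C1_onI[OF has_derivative_add[OF assms[THEN C1_on_has_derivative]]], assumption, assumption)
    (use assms[THEN C1_on_pderiv_dir] in \<open>auto simp: pderiv_dir_def[abs_def] intro: continuous_on_add\<close>)

lemma C1_on_sum:
  assumes "\<And>i. i \<in> I \<Longrightarrow> C1_on S (f i)"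
  shows "C1_on S (\<lambda>x. \<Sum>i\<in>I. f i x)"
  using assms by (induction I rule: infinite_finite_induct) (auto intro: C1_on_const C1_on_add)

lemma pderiv_dir_scaleR:
  assumes "f differentiable (at x)" "g differentiable (at x)"
  shows "pderiv_dir h (\<lambda>x. f x *\<^sub>R g x) x = f x *\<^sub>R pderiv_dir h g x + pderiv_dir h f x *\<^sub>R g x"
  using pderiv_dir_eq[OF has_derivative_scaleR[OF assms[unfolded frechet_derivative_works]]]
  by (simp add: pderiv_dir_def)

lemma C1_on_scaleR:
  assumes "C1_on S f" "C1_on S g"
  shows "C1_on S (\<lambda>x. f x *\<^sub>R g x)"
  by (rule C1_onI[OF has_derivative_scaleR[OF assms[THEN C1_on_has_derivative]]], assumption, assumption)
    (use assms[THEN C1_on_pderiv_dir] assms[THEN C1_on_continuous] in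
      \<open>auto simp: pderiv_dir_def[abs_def] intro!: continuous_intros\<close>)

lemma C1_on_mult:
  fixes f g :: "real ^ 'n \<Rightarrow> real"
  shows "C1_on S f \<Longrightarrow> C1_on S g \<Longrightarrow> C1_on S (\<lambda>x. f x * g x)"
  using C1_on_scaleR[of S f g] by simp

lemma pderiv_dir_const [simp]: "pderiv_dir h (\<lambda>_. c) x = 0"
  using pderiv_dir_eq[OF has_derivative_const] .

lemma pderiv_dir_mult:
  fixes f g :: "real ^ 'n \<Rightarrow> real"
  shows "f differentiable (at x) \<Longrightarrow> g differentiable (at x) \<Longrightarrow>
    pderiv_dir h (\<lambda>x. f x * g x) x = f x * pderiv_dir h g x + pderiv_dir h f x * g x"
  using pderiv_dir_scaleR[of f x g h] by simp

lemma pderiv_dir_compose: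
  assumes "f differentiable (at x)" "(g has_derivative g') (at (f x))"
  shows "pderiv_dir h (\<lambda>x. g (f x)) x = g' (pderiv_dir h f x)"
  using pderiv_dir_eq[OF has_derivative_compose[OF assms(1)[unfolded frechet_derivative_works] assms(2)]]
  by (simp add: pderiv_dir_def)

text \<open>The partial derivatives of the composition are \<open>g' (f x)\<close> applied to those
  of \<open>f\<close>. Joint continuity of \<open>g'\<close> in base point and direction makes them
  continuous. The set \<open>T\<close> may leave out points, such as 0, where \<open>g\<close> is
  not differentiable.\<close>

lemma C1_on_compose:
  assumes f: "C1_on S f" and g: "\<And>y. y \<in> T \<Longrightarrow> (g has_derivative g' y) (at y)"
    and T: "\<And>x. x \<in> S \<Longrightarrow> f x \<in> T"
    and c: "continuous_on (T \<times> UNIV) (\<lambda>(y, q). g' y q)"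
  shows "C1_on S (\<lambda>x. g (f x))"
proof (rule C1_onI[OF has_derivative_compose[OF C1_on_has_derivative[OF f] g[OF T]]], assumption+)
  fix h
  have "continuous_on S (\<lambda>x. (f x, pderiv_dir h f x))"
    using f by (intro continuous_on_Pair C1_on_continuous C1_on_pderiv_dir)
  from continuous_on_compose2[OF c this] T
  show "continuous_on S (\<lambda>x. g' (f x) (frechet_derivative f (at x) (axis h 1)))"
    by (auto simp: pderiv_dir_def[abs_def] image_subset_iff)
qed

lemma C1_on_compose_real:
  fixes f :: "real ^ 'n \<Rightarrow> real"
  assumes f: "C1_on S f" and g: "\<And>y::real. (g has_real_derivative g' y) (at y)" "continuous_on UNIV g'"
  shows "C1_on S (\<lambda>x. g (f x))"
  by (rule C1_on_compose[OF f, where T = UNIV and g' = "\<lambda>y. (*) (g' y)"])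
    (use g in \<open>auto simp: has_field_derivative_def split_beta
       intro!: continuous_intros continuous_on_compose2[OF g(2)]\<close>)

lemma pderiv_dir_compose_real:
  fixes f :: "real ^ 'n \<Rightarrow> real"
  assumes "f differentiable (at x)" "(g has_real_derivative g') (at (f x))"
  shows "pderiv_dir h (\<lambda>x. g (f x)) x = g' * pderiv_dir h f x"
  using pderiv_dir_compose[OF assms[unfolded has_field_derivative_def]] .

lemma pderiv_dir_eq_0_outside_support:
  assumes "x \<notin> closure {x. f x \<noteq> 0}"
  shows "pderiv_dir h f x = 0"
proof -
  have "pderiv_dir h f x = pderiv_dir h (\<lambda>_. 0) x"
    by (rule pderiv_dir_cong_open[where S = "- closure {x. f x \<noteq> 0}"])
      (use assms closure_subset[of "{x. f x \<noteq> 0}"] in auto)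
  then show ?thesis by simp
qed

section \<open>Continuously differentiable cutoff functions\<close>

lemma has_derivative_pos_part_square:
  "((\<lambda>t::real. (max 0 t)\<^sup>2) has_real_derivative 2 * max 0 t) (at t)"
proof -
  consider "t > 0" | "t < 0" | "t = 0" by linarith
  then show ?thesis
  proof cases
    case 1
    have "((\<lambda>t. t\<^sup>2) has_real_derivative 2 * max 0 t) (at t)"
      using 1 by (auto intro!: derivative_eq_intros)
    then show ?thesis
      by (rule has_field_derivative_transform_within_open[where S = "{0<..}"]) (use 1 in auto)
  next
    case 2
    have "((\<lambda>t. 0) has_real_derivative 2 * max 0 t) (at t)"
      using 2 by (auto intro!: derivative_eq_intros)
    then show ?thesis
      by (rule has_field_derivative_transform_within_open[where S = "{..<0}"]) (use 2 in auto)
  next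
    case 3
    have "((\<lambda>h::real. max 0 h) \<longlongrightarrow> max 0 0) (at 0)"
      by (intro tendsto_intros)
    moreover have "((max 0 h)\<^sup>2 - 0) / h = max 0 h" for h :: real
      by (auto simp: max_def power2_eq_square)
    ultimately show ?thesis
      using 3 by (simp add: DERIV_def)
  qed
qed

lemma C1_on_pos_part_square:
  fixes f :: "real ^ 'n \<Rightarrow> real"
  shows "C1_on S f \<Longrightarrow> C1_on S (\<lambda>x. (max 0 (f x))\<^sup>2)"
  by (rule C1_on_compose_real[OF _ has_derivative_pos_part_square]) (auto intro!: continuous_intros)

text \<open>Finitely many balls whose closed versions lie in \<open>U\<close> cover
  \<open>K\<close>. The sum \<open>B\<close> of bumps on these balls is bounded below by some
  \<open>c > 0\<close> on \<open>K\<close>, and clipping \<open>B\<close> at the level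
  \<open>c\<close> by means of a squared positive part keeps it continuously differentiable.\<close>

lemma C1_Urysohn:
  fixes K U :: "(real ^ 'n) set"
  assumes K: "compact K" and U: "open U" "K \<subseteq> U"
  obtains \<psi> :: "real ^ 'n \<Rightarrow> real"
  where "C1_on UNIV \<psi>" "\<And>x. 0 \<le> \<psi> x" "\<And>x. \<psi> x \<le> 1" "\<And>x. x \<in> K \<Longrightarrow> \<psi> x = 1"
    "compact (closure {x. \<psi> x \<noteq> 0})" "closure {x. \<psi> x \<noteq> 0} \<subseteq> U"
proof -
  have "\<exists>r>0. cball x r \<subseteq> U" if "x \<in> K" for x
    using U that open_contains_cball by blast
  then obtain r where r: "\<And>x. x \<in> K \<Longrightarrow> r x > 0" "\<And>x. x \<in> K \<Longrightarrow> cball x (r x) \<subseteq> U" by metis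
  have "K \<subseteq> (\<Union>x\<in>K. ball x (r x))" using r(1) by force
  then obtain I where I: "I \<subseteq> K" "finite I" "K \<subseteq> (\<Union>x\<in>I. ball x (r x))"
    using compactE_image[OF K, of K "\<lambda>x. ball x (r x)"] by auto
  \<comment> \<open>A bump that is positive exactly inside the ball of radius \<open>r x\<close>
    about \<open>x\<close>. The squared distance is expanded in coordinates, with sums and products
    only, so that the closure rules for \<open>C1_on\<close> apply.\<close>
  define b where "b x y = (max 0 ((r x)\<^sup>2 + (-1) * (\<Sum>i\<in>UNIV. (y $ i + - x $ i) * (y $ i + - x $ i))))\<^sup>2" for x y :: "real ^ 'n"
  have b_dist: "b x y = (max 0 ((r x)\<^sup>2 - (dist x y)\<^sup>2))\<^sup>2" for x y
  proof -
    have "(dist x y)\<^sup>2 = (\<Sum>i\<in>UNIV. (y $ i + - x $ i)\<^sup>2)"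
      by (simp add: dist_norm norm_vec_def L2_set_def sum_nonneg power2_commute)
    then show ?thesis by (simp add: b_def power2_eq_square)
  qed
  have b0: "b x y \<ge> 0" for x y by (simp add: b_def)
  have bpos: "b x y > 0 \<longleftrightarrow> dist x y < r x" if "x \<in> I" for x y
    using r(1)[of x] that I(1) unfolding b_dist
    by (auto simp: max_def abs_square_less_1 dest: power2_less_imp_less intro!: power_strict_mono)
  define B where "B y = (\<Sum>x\<in>I. b x y)" for y
  have B0: "B y \<ge> 0" for y by (simp add: B_def b0 sum_nonneg)
  have BC1: "C1_on UNIV B"
    unfolding B_def b_def
    by (intro C1_on_sum C1_on_pos_part_square C1_on_add C1_on_const C1_on_mult C1_on_nth)
  have Bpos: "B y > 0" if "y \<in> K" for y
  proof -
    from that I obtain x where x: "x \<in> I" "dist x y < r x" by auto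
    then have "b x y > 0" using bpos by simp
    then show ?thesis unfolding B_def
      using sum_pos2[OF I(2) x(1), of "\<lambda>x. b x y"] b0 by auto
  qed
  \<comment> \<open>By compactness \<open>B\<close> has a positive minimum on \<open>K\<close>; for
    empty \<open>K\<close> any positive number serves.\<close>
  obtain c where c: "c > 0" "\<And>y. y \<in> K \<Longrightarrow> B y \<ge> c"
  proof (cases "K = {}")
    case True
    then show ?thesis using that[of 1] by auto
  next
    case False
    from continuous_attains_inf[OF K False continuous_on_subset[OF C1_on_continuous[OF BC1]]]
    obtain z where "z \<in> K" "\<forall>y\<in>K. B z \<le> B y" by auto
    then show ?thesis using that[of "B z"] Bpos by auto
  qed
  \<comment> \<open>This is 1 - (max 0 (1 - B/c))^2: it equals 1 where \<open>B\<close> is at least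
    \<open>c\<close>, 0 where \<open>B\<close> vanishes, and stays in [0, 1] because
    \<open>B\<close> is non-negative.\<close>
  define \<psi> where "\<psi> y = 1 + (-1) * (max 0 (1 + (-1/c) * B y))\<^sup>2" for y
  define T where "T = (\<Union>x\<in>I. cball x (r x))"
  have T: "compact T" "T \<subseteq> U" unfolding T_def using I r(2) by (auto intro!: compact_UN)
  have supp: "closure {x. \<psi> x \<noteq> 0} \<subseteq> T"
  proof (rule closure_minimal)
    show "{x. \<psi> x \<noteq> 0} \<subseteq> T"
    proof (clarsimp)
      fix y assume "\<psi> y \<noteq> 0"
      then have "B y \<noteq> 0" by (auto simp: \<psi>_def)
      then obtain x where "x \<in> I" "b x y \<noteq> 0" unfolding B_def by (meson sum.neutral)
      then show "y \<in> T" using bpos[of x y] b0[of x y] by (force simp: T_def)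
    qed
    show "closed T" using T(1) by (rule compact_imp_closed)
  qed
  have range: "0 \<le> max 0 (1 - B y / c) \<and> max 0 (1 - B y / c) \<le> 1" for y
    using B0[of y] c(1) by (auto simp: divide_nonneg_pos)
  show ?thesis
  proof
    show "C1_on UNIV \<psi>" unfolding \<psi>_def
      by (intro C1_on_pos_part_square C1_on_add C1_on_const C1_on_mult BC1)
    show "0 \<le> \<psi> x" "\<psi> x \<le> 1" for x
      using range[of x] by (auto simp: \<psi>_def intro: power_le_one)
    show "\<psi> x = 1" if "x \<in> K" for x
      using c(2)[OF that] c(1) by (simp add: \<psi>_def)
    show "compact (closure {x. \<psi> x \<noteq> 0})"
      by (metis supp T(1) closed_closure compact_Int_closed Int_absorb1)
    show "closure {x. \<psi> x \<noteq> 0} \<subseteq> U" using supp T by blast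
  qed
qed

section \<open>Admissible functions\<close>

lemma admissible_pos: "admissible \<phi> \<Longrightarrow> s > 0 \<Longrightarrow> \<phi> s > 0"
  by (simp add: admissible_def)

lemma admissible_DERIV:
  "admissible \<phi> \<Longrightarrow> s > 0 \<Longrightarrow> (\<phi> has_real_derivative deriv \<phi> s) (at s)"
  by (simp add: admissible_def DERIV_deriv_iff_real_differentiable)

lemma admissible_continuous:
  assumes "admissible \<phi>"
  shows "continuous_on {0<..} \<phi>" "continuous_on {0<..} (deriv \<phi>)"
proof -
  show "continuous_on {0<..} \<phi>"
    using DERIV_isCont[OF admissible_DERIV[OF assms]] by (simp add: continuous_at_imp_continuous_on)
  show "continuous_on {0<..} (deriv \<phi>)"
    using assms by (simp add: admissible_def)
qed

lemma admissible_DERIV_mult: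
  assumes "admissible \<phi>" "s > 0"
  shows "((\<lambda>s. s * \<phi> s) has_real_derivative \<phi> s + s * deriv \<phi> s) (at s)"
  using admissible_DERIV[OF assms] by (auto intro!: derivative_eq_intros)

lemma admissible_deriv_mult:
  assumes "admissible \<phi>" "s > 0"
  shows "deriv (\<lambda>s. s * \<phi> s) s = \<phi> s + s * deriv \<phi> s"
  using admissible_DERIV_mult[OF assms] by (rule DERIV_imp_deriv)

lemma admissible_deriv_mult_pos:
  assumes "admissible \<phi>" "s > 0"
  shows "\<phi> s + s * deriv \<phi> s > 0"
proof -
  have "deriv (\<lambda>s. s * \<phi> s) s > 0" using assms by (simp add: admissible_def)
  then show ?thesis by (simp add: admissible_deriv_mult[OF assms])
qed

lemma admissible_strict_mono:
  assumes "admissible \<phi>" "0 < a" "a < b"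
  shows "a * \<phi> a < b * \<phi> b"
proof (rule DERIV_pos_imp_increasing[OF assms(3)])
  fix x assume "a \<le> x" "x \<le> b"
  then have "x > 0" using assms by simp
  then show "\<exists>y. ((\<lambda>s. s * \<phi> s) has_real_derivative y) (at x) \<and> 0 < y"
    using admissible_DERIV_mult admissible_deriv_mult_pos assms(1) by blast
qed

section \<open>The differential of the map v -> \<phi>(|v|) v\<close>

definition dPhi :: "(real \<Rightarrow> real) \<Rightarrow> 'a::real_inner \<Rightarrow> 'a \<Rightarrow> 'a" where
  "dPhi \<phi> v p = \<phi> (norm v) *\<^sub>R p + (deriv \<phi> (norm v) * inner p v / norm v) *\<^sub>R v"

lemma has_derivative_dPhi:
  fixes v :: "'a::real_inner"
  assumes "admissible \<phi>" "v \<noteq> 0"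
  shows "((\<lambda>v. \<phi> (norm v) *\<^sub>R v) has_derivative dPhi \<phi> v) (at v)"
proof -
  have "((\<lambda>v. \<phi> (norm v)) has_derivative (\<lambda>p. deriv \<phi> (norm v) * inner p (sgn v))) (at v)"
    using has_derivative_compose[OF has_derivative_norm[OF assms(2)], of \<phi> "(*) (deriv \<phi> (norm v))"]
      admissible_DERIV[OF assms(1), of "norm v"] assms(2)
    by (simp add: has_field_derivative_def)
  from has_derivative_scaleR[OF this has_derivative_ident]
  show ?thesis
    by (rule has_derivative_eq_rhs) (auto simp: dPhi_def sgn_div_norm fun_eq_iff divide_simps)
qed

lemma continuous_on_dPhi:
  assumes "admissible \<phi>"
  shows "continuous_on ((- {0}) \<times> UNIV) (\<lambda>(v::'a::real_inner, p). dPhi \<phi> v p)"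
  unfolding dPhi_def split_beta
  by (intro continuous_intros continuous_on_compose2[OF admissible_continuous(1)[OF assms]]
      continuous_on_compose2[OF admissible_continuous(2)[OF assms]]) auto

lemma dPhi_diff: "dPhi \<phi> v (p - q) = dPhi \<phi> v p - dPhi \<phi> v q"
  by (simp add: dPhi_def inner_diff_left scaleR_diff_right scaleR_diff_left algebra_simps diff_divide_distrib)

lemma dPhi_scaleR: "dPhi \<phi> v (c *\<^sub>R p) = c *\<^sub>R dPhi \<phi> v p"
  by (simp add: dPhi_def scaleR_add_right mult_ac)

text \<open>By Cauchy-Schwarz the operator norm of \<open>dPhi \<phi> v\<close> is at most
  |\<phi>(s)| + |\<phi>'(s)| s with s = |v|, a continuous function on a compact interval away from
  0. The bound is uniform in \<open>v\<close>, which will run through the values of a whole sequence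
  of test functions.\<close>

lemma dPhi_bounded:
  assumes "admissible \<phi>" "0 < a"
  obtains M where "M \<ge> 0" "\<And>v p::'a::real_inner. a \<le> norm v \<Longrightarrow> norm v \<le> b \<Longrightarrow> norm (dPhi \<phi> v p) \<le> M * norm p"
proof -
  have "continuous_on {a..b} (\<lambda>s. \<bar>\<phi> s\<bar> + \<bar>deriv \<phi> s\<bar> * s)"
    using assms(2)
    by (intro continuous_intros continuous_on_subset[OF admissible_continuous(1)[OF assms(1)]]
      continuous_on_subset[OF admissible_continuous(2)[OF assms(1)]]) auto
  then have "bounded ((\<lambda>s. \<bar>\<phi> s\<bar> + \<bar>deriv \<phi> s\<bar> * s) ` {a..b})"
    by (intro compact_imp_bounded compact_continuous_image) auto
  then obtain M where M: "\<And>s. s \<in> {a..b} \<Longrightarrow> norm (\<bar>\<phi> s\<bar> + \<bar>deriv \<phi> s\<bar> * s) \<le> M"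
    by (metis (no_types, lifting) bounded_iff imageI)
  show ?thesis
  proof (rule that[of "max 0 M"])
    fix v p :: 'a assume v: "a \<le> norm v" "norm v \<le> b"
    have "norm (dPhi \<phi> v p) \<le> \<bar>\<phi> (norm v)\<bar> * norm p + \<bar>deriv \<phi> (norm v)\<bar> * \<bar>inner p v\<bar>"
      unfolding dPhi_def using v assms(2) by (intro order_trans[OF norm_triangle_ineq]) (simp add: abs_mult)
    also have "\<dots> \<le> \<bar>\<phi> (norm v)\<bar> * norm p + \<bar>deriv \<phi> (norm v)\<bar> * (norm p * norm v)"
      by (intro add_left_mono mult_left_mono Cauchy_Schwarz_ineq2) auto
    also have "\<dots> = (\<bar>\<phi> (norm v)\<bar> + \<bar>deriv \<phi> (norm v)\<bar> * norm v) * norm p"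
      by (simp add: algebra_simps)
    also have "\<dots> \<le> max 0 M * norm p"
      using M[of "norm v"] v by (intro mult_right_mono) auto
    finally show "norm (dPhi \<phi> v p) \<le> max 0 M * norm p" .
  qed simp
qed

lemma admissible_growth:
  assumes "admissible \<phi>"
  shows "\<exists>s0>0. \<exists>C>0. \<exists>r>-1. \<forall>s\<in>{0<..<s0}. deriv (\<lambda>s. s * \<phi> s) s \<le> C * s powr r"
proof -
  have "\<exists>s0>0. \<exists>C1>0. \<exists>C>0. \<exists>r>-1.
    (\<forall>s\<in>{0<..<s0}. C1 * s powr r \<le> deriv (\<lambda>s. s * \<phi> s) s \<and> deriv (\<lambda>s. s * \<phi> s) s \<le> C * s powr r)"
    using assms unfolding admissible_def
    apply (elim conjE exE)
    subgoal for s0 C1 s1 C2 r by (intro exI[of _ s0] exI[of _ C1] exI[of _ C2] exI[of _ r] conjI)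
    done
  then show ?thesis by meson
qed

text \<open>The power \<open>k\<close> is chosen with \<open>k (r + 1) \<ge> 2\<close>, where \<open>r\<close> is the exponent of the growth condition
  near \<open>0\<close>; then the cutoff \<open>\<psi>\<^sup>k\<close> and its image under \<open>v \<mapsto> \<phi>(|v|) v\<close> are both continuously differentiable.\<close>

lemma admissible_power_profile:
  fixes c :: real
  assumes adm: "admissible \<phi>" and c: "c > 0"
  obtains k :: nat and h' :: "real \<Rightarrow> real" where "k > 0" "continuous_on UNIV h'"
    "\<And>t. ((\<lambda>t. if t > 0 then \<phi> (c * t ^ k) * t ^ k else 0) has_real_derivative h' t) (at t)"
proof -
  define F where "F s = s * \<phi> s" for s
  define dF where "dF s = \<phi> s + s * deriv \<phi> s" for s
  obtain s0 C2 r where s0: "s0 > 0" "C2 > 0" "r > -1"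
    and C2: "\<And>s. s \<in> {0<..<s0} \<Longrightarrow> deriv (\<lambda>s. s * \<phi> s) s \<le> C2 * s powr r"
    using admissible_growth[OF adm] by blast
  have dF_le: "dF s \<le> C2 * s powr r" if "0 < s" "s < s0" for s
    using C2[of s] admissible_deriv_mult[OF adm that(1)] that by (simp add: dF_def)
  have dF: "(F has_real_derivative dF s) (at s)" "dF s > 0" if "s > 0" for s
    using admissible_DERIV_mult[OF adm that] admissible_deriv_mult_pos[OF adm that]
    by (simp_all add: F_def[abs_def] dF_def)
  define C where "C = C2 / (r + 1)"
  have C: "C > 0" using s0 by (simp add: C_def)
  \<comment> \<open>Integrated form of the growth bound. An integration from 0 would use that
    \<open>F\<close> tends to 0 there; in its place, \<open>F\<close> takes arbitrarily small values
    because its range is (0, \<infinity>).\<close>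
  have F_le: "F y \<le> C * y powr (r + 1)" if y: "0 < y" "y < s0" for y
  proof (rule ccontr)
    define D where "D z = C * z powr (r + 1) - F z" for z
    assume "\<not> ?thesis"
    then have Dy: "D y < 0" by (simp add: D_def)
    \<comment> \<open>The value is chosen so that \<open>D z \<ge> - F z = D y / 2 > D y\<close>,
      although \<open>z < y\<close> and \<open>D\<close> is non-decreasing on the interval from
      \<open>z\<close> to \<open>y\<close>.\<close>
    have "- D y / 2 \<in> (\<lambda>s. s * \<phi> s) ` {0<..}" using adm Dy by (simp add: admissible_def)
    then obtain z where z: "z > 0" "F z = - D y / 2" by (auto simp: F_def)
    have "F z < F y" using z C y Dy by (simp add: D_def) (smt (verit) mult_pos_pos powr_gt_zero)
    then have zy: "z < y"
      using admissible_strict_mono[OF adm y(1), of z] by (cases z y rule: linorder_cases) (auto simp: F_def)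
    have "D z \<le> D y"
    proof (rule DERIV_nonneg_imp_nondecreasing[OF less_imp_le[OF zy]])
      fix x assume "z \<le> x" "x \<le> y"
      then have x: "0 < x" "x < s0" using z y by auto
      have "(D has_real_derivative C * ((r + 1) * x powr r) - dF x) (at x)"
        unfolding D_def[abs_def] using x dF(1) by (auto intro!: derivative_eq_intros)
      moreover have "C * ((r + 1) * x powr r) = C2 * x powr r" using s0 by (simp add: C_def)
      ultimately show "\<exists>d. (D has_real_derivative d) (at x) \<and> d \<ge> 0"
        using dF_le[OF x] by (metis diff_ge_0_iff_ge)
    qed
    moreover have "D z \<ge> - F z" using C by (simp add: D_def)
    ultimately show False using z Dy by simp
  qed
  obtain k0 :: nat where k0: "2 / (r + 1) < of_nat k0" using reals_Archimedean2 by blast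
  have k0pos: "k0 > 0" using k0 s0 by (intro gr0I) (auto simp: divide_less_0_iff)
  have kr: "real k0 * (r + 1) \<ge> 2" using k0 s0 by (simp add: divide_less_eq)
  define h where "h t = (if t > 0 then \<phi> (c * t ^ k0) * t ^ k0 else 0)" for t
  define h' where "h' t = (if t > 0 then dF (c * t ^ k0) * (real k0 * t ^ (k0 - 1)) else 0)" for t
  have h_F: "h t = F (c * t ^ k0) / c" if "t > 0" for t
    using that c by (simp add: h_def F_def)
  have small: "eventually (\<lambda>t. c * \<bar>t\<bar> ^ k0 < s0 \<and> \<bar>t\<bar> < 1) (at 0)"
  proof -
    have "((\<lambda>t. c * \<bar>t\<bar> ^ k0) \<longlongrightarrow> c * \<bar>0\<bar> ^ k0) (at 0)" "((\<lambda>t::real. \<bar>t\<bar>) \<longlongrightarrow> \<bar>0\<bar>) (at 0)"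
      by (intro tendsto_intros)+
    with k0pos s0 show ?thesis
      by (intro eventually_conj order_tendstoD(2)[where a = s0] order_tendstoD(2)[where a = 1]) (auto simp: power_0_left)
  qed
  have powr_k: "(c * t ^ k0) powr q = c powr q * t powr (real k0 * q)" if "t > 0" for t q
  proof -
    have "t ^ k0 = t powr real k0" using that by (simp add: powr_realpow)
    then show ?thesis using that c by (simp only: powr_mult powr_powr)
  qed
  define M where "M = C * c powr (r + 1) / c"
  define M' where "M' = C2 * c powr r * real k0"
  have M': "M' \<ge> 0" using s0 by (simp add: M'_def)
  \<comment> \<open>Since \<open>t < 1\<close> and \<open>k0 * (r + 1) \<ge> 2\<close>, the function
    \<open>h\<close> is of order t^2 at 0 and so has derivative 0 there. The linear bound
    \<open>h'_le\<close> gives the continuity of \<open>h'\<close> at 0 in the same way.\<close>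
  have h_le: "\<bar>h t\<bar> \<le> M * t\<^sup>2" if "c * \<bar>t\<bar> ^ k0 < s0" "\<bar>t\<bar> < 1" for t
  proof (cases "t > 0")
    case True
    have "h t \<le> C * (c * t ^ k0) powr (r + 1) / c"
      unfolding h_F[OF True] using F_le[of "c * t ^ k0"] True c that by (intro divide_right_mono) auto
    also have "\<dots> = M * t powr (real k0 * (r + 1))"
      unfolding powr_k[OF True] M_def by simp
    also have "\<dots> \<le> M * t powr 2"
      using True that kr C c by (intro mult_left_mono powr_mono') (auto simp: M_def)
    finally have "h t \<le> M * t\<^sup>2" using True by simp
    moreover have "h t \<ge> 0" using True c admissible_pos[OF adm, of "c * t ^ k0"] by (simp add: h_def)
    ultimately show ?thesis by simp
  qed (use C c in \<open>auto simp: h_def M_def\<close>)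
  have h'_le: "\<bar>h' t\<bar> \<le> M' * \<bar>t\<bar>" if "c * \<bar>t\<bar> ^ k0 < s0" "\<bar>t\<bar> < 1" for t
  proof (cases "t > 0")
    case True
    have "t ^ (k0 - 1) = t powr (real k0 - 1)"
      using True k0pos by (simp add: powr_realpow flip: of_nat_diff) (metis One_nat_def Suc_pred' of_nat_1 of_nat_diff powr_realpow Suc_leI)
    then have "t powr (real k0 * r) * t ^ (k0 - 1) = t powr (real k0 * (r + 1) - 1)"
      by (simp add: algebra_simps flip: powr_add)
    also have "\<dots> \<le> t powr 1" using True that kr by (intro powr_mono') auto
    finally have le: "t powr (real k0 * r) * t ^ (k0 - 1) \<le> t" using True by simp
    have "h' t \<le> C2 * (c * t ^ k0) powr r * (real k0 * t ^ (k0 - 1))"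
      using True dF_le[of "c * t ^ k0"] c that by (simp add: h'_def mult_right_mono)
    also have "\<dots> = M' * (t powr (real k0 * r) * t ^ (k0 - 1))"
      unfolding powr_k[OF True] M'_def by simp
    also have "\<dots> \<le> M' * t" using le s0 by (intro mult_left_mono) (auto simp: M'_def)
    finally have "h' t \<le> M' * t" .
    moreover have "h' t \<ge> 0" using True c dF(2)[of "c * t ^ k0"] by (simp add: h'_def)
    ultimately show ?thesis using True by simp
  qed (use M' in \<open>auto simp: h'_def mult_nonneg_nonpos\<close>)
  have deriv_h: "(h has_real_derivative h' t) (at t)" for t
  proof -
    consider "t > 0" | "t < 0" | "t = 0" by linarith
    then show ?thesis
    proof cases
      case 1
      have "((\<lambda>t. c * t ^ k0) has_real_derivative c * (real k0 * t ^ (k0 - 1))) (at t)"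
        by (auto intro!: derivative_eq_intros)
      from DERIV_cdivide[OF DERIV_chain2[OF dF(1) this], of c]
      have "((\<lambda>t. F (c * t ^ k0) / c) has_real_derivative h' t) (at t)"
        using 1 c by (simp add: h'_def)
      then show ?thesis
        by (rule has_field_derivative_transform_within_open[where S = "{0<..}"]) (use 1 h_F in auto)
    next
      case 2
      have "((\<lambda>t. 0) has_real_derivative h' t) (at t)"
        using 2 by (auto simp: h'_def)
      then show ?thesis
        by (rule has_field_derivative_transform_within_open[where S = "{..<0}"]) (use 2 in \<open>auto simp: h_def\<close>)
    next
      case 3
      have "((\<lambda>t. h t / t) \<longlongrightarrow> 0) (at 0)"
      proof (rule Lim_null_comparison)
        show "eventually (\<lambda>t. norm (h t / t) \<le> M * \<bar>t\<bar>) (at 0)"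
          using small
        proof eventually_elim
          case (elim t)
          then have "\<bar>h t\<bar> \<le> M * (\<bar>t\<bar> * \<bar>t\<bar>)" using h_le[of t] by (simp add: power2_eq_square)
          then show ?case by (cases "t = 0") (simp_all add: pos_divide_le_eq mult.assoc)
        qed
        show "((\<lambda>t. M * \<bar>t\<bar>) \<longlongrightarrow> 0) (at 0)"
          by (auto intro!: tendsto_eq_intros)
      qed
      then show ?thesis using 3 by (simp add: DERIV_def h_def[of 0] h'_def)
    qed
  qed
  have cont: "isCont h' t" for t
  proof -
    consider "t > 0" | "t < 0" | "t = 0" by linarith
    then show ?thesis
    proof cases
      case 1
      have "continuous_on {0<..} (\<lambda>t. dF (c * t ^ k0) * (real k0 * t ^ (k0 - 1)))"
        unfolding dF_def using c
        by (intro continuous_intros continuous_on_compose2[OF admissible_continuous(1)[OF adm]]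
          continuous_on_compose2[OF admissible_continuous(2)[OF adm]]) auto
      then have "continuous_on {0<..} h'"
        by (rule continuous_on_eq) (auto simp: h'_def)
      then show ?thesis using 1 by (simp add: continuous_on_eq_continuous_at)
    next
      case 2
      have "continuous_on {..<0} (\<lambda>t::real. 0::real)" by simp
      then have "continuous_on {..<0} h'"
        by (rule continuous_on_eq) (auto simp: h'_def)
      then show ?thesis using 2 by (simp add: continuous_on_eq_continuous_at)
    next
      case 3
      have "(h' \<longlongrightarrow> 0) (at 0)"
      proof (rule Lim_null_comparison)
        show "eventually (\<lambda>t. norm (h' t) \<le> M' * \<bar>t\<bar>) (at 0)"
          using small by eventually_elim (use h'_le in auto)
        show "((\<lambda>t. M' * \<bar>t\<bar>) \<longlongrightarrow> 0) (at 0)"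
          by (auto intro!: tendsto_eq_intros)
      qed
      then show ?thesis using 3 by (simp add: isCont_def h'_def)
    qed
  qed
  show ?thesis
    by (rule that[OF k0pos _ deriv_h[unfolded h_def[abs_def]]])
      (simp add: cont continuous_at_imp_continuous_on)
qed

section \<open>The growth exponent of \<phi>, and \<Lambda> in the parameter s\<close>

definition growth_exponent :: "(real \<Rightarrow> real) \<Rightarrow> real \<Rightarrow> real" where
  "growth_exponent \<phi> s = s * deriv \<phi> s / \<phi> s"

text \<open>The derivative of s \<phi>(s) is \<phi>(s) times 1 plus the exponent, so its positivity
  says exactly that the exponent exceeds -1. For \<phi>(s) = s^(p-2) the exponent is the constant p
  - 2.\<close>

lemma growth_exponent_gt:
  assumes "admissible \<phi>" "s > 0" shows "growth_exponent \<phi> s > -1"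
  using admissible_deriv_mult_pos[OF assms] admissible_pos[OF assms]
  by (simp add: growth_exponent_def pos_less_divide_eq)

lemma growth_exponent_abs_mono:
  assumes "admissible \<phi>" "0 < s" "s \<le> t"
  shows "\<bar>growth_exponent \<phi> s\<bar> \<le> \<bar>growth_exponent \<phi> t\<bar>"
proof -
  have "mono_on {0<..} (\<lambda>s. \<bar>growth_exponent \<phi> s\<bar>)" using assms(1) by (simp add: admissible_def growth_exponent_def)
  then show ?thesis using assms by (auto simp: mono_on_def)
qed

lemma growth_exponent_continuous:
  assumes "admissible \<phi>"
  shows "continuous_on {0<..} (growth_exponent \<phi>)"
  unfolding growth_exponent_def[abs_def] using admissible_pos[OF assms]
  by (intro continuous_intros admissible_continuous[OF assms]) force

text \<open>Otherwise the intermediate value theorem gives a zero to the right of \<open>s\<close>,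
  where the absolute value would have dropped below its value at \<open>s\<close>, contrary to
  monotonicity.\<close>

lemma growth_exponent_same_sign:
  assumes "admissible \<phi>" "0 < s" "s \<le> t" "growth_exponent \<phi> s \<noteq> 0"
  shows "growth_exponent \<phi> s * growth_exponent \<phi> t > 0"
proof (rule ccontr)
  assume neg: "\<not> ?thesis"
  have c: "continuous_on {s..t} (growth_exponent \<phi>)"
    by (rule continuous_on_subset[OF growth_exponent_continuous[OF assms(1)]]) (use assms in auto)
  have "\<exists>x\<ge>s. x \<le> t \<and> growth_exponent \<phi> x = 0"
  proof (cases "growth_exponent \<phi> s > 0")
    case True
    then have "growth_exponent \<phi> t \<le> 0" using neg by (simp add: zero_less_mult_iff)
    then show ?thesis using IVT2'[of "growth_exponent \<phi>" t 0 s] True assms c by auto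
  next
    case False
    then have "growth_exponent \<phi> t \<ge> 0" using neg assms(4) by (simp add: zero_less_mult_iff)
    then show ?thesis using IVT'[of "growth_exponent \<phi>" s 0 t] False assms c by auto
  qed
  then obtain x where "x \<ge> s" "growth_exponent \<phi> x = 0" by auto
  then show False using growth_exponent_abs_mono[OF assms(1,2), of x] assms(4) by simp
qed

text \<open>\<open>Lambda\<close> after the change of variable t = s sqrt(\<phi>(s)), with numerator
  and denominator divided by \<phi>(s). Working with s avoids the inverse function inside
  \<open>Lambda\<close>.\<close>

definition Lambda_at :: "(real \<Rightarrow> real) \<Rightarrow> real \<Rightarrow> real" where
  "Lambda_at \<phi> s = - growth_exponent \<phi> s / (growth_exponent \<phi> s + 2)"

lemma Lambda_eq_Lambda_at:
  assumes "admissible \<phi>" "s > 0"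
  shows "Lambda \<phi> (s * sqrt (\<phi> s)) = Lambda_at \<phi> s"
proof -
  have p: "\<phi> s > 0" using admissible_pos[OF assms] .
  have "growth_exponent \<phi> s + 2 = (s * deriv \<phi> s + 2 * \<phi> s) / \<phi> s" using p by (simp add: growth_exponent_def field_simps)
  then show ?thesis using p by (simp add: Lambda_eq[OF assms] Lambda_at_def) (simp add: growth_exponent_def)
qed

text \<open>\<open>Lambda_at\<close> vanishes as long as \<open>growth_exponent\<close> does; afterwards \<open>growth_exponent\<close> keeps
  its sign, so that \<open>\<bar>Lambda_at\<bar>\<close> is non-decreasing.\<close>

lemma Lambda_at_mono_sign:
  assumes "admissible \<phi>"
  obtains e :: real where "e = 1 \<or> e = -1" "mono_on {0<..} (\<lambda>s. e * Lambda_at \<phi> s)"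
    "\<And>s. s > 0 \<Longrightarrow> 0 \<le> e * Lambda_at \<phi> s" "\<And>s. s > 0 \<Longrightarrow> e * Lambda_at \<phi> s \<le> 1"
proof -
  \<comment> \<open>\<open>e\<close> is opposite in sign to the growth exponent. The map x -> -x /
    (x + 2) is decreasing for x > -1 and takes values between -1 and 1 there, so the monotonicity of
    the absolute value of the exponent passes to \<open>e * Lambda_at\<close>.\<close>
  have *: "0 \<le> e * Lambda_at \<phi> s \<and> e * Lambda_at \<phi> s \<le> e * Lambda_at \<phi> t \<and> e * Lambda_at \<phi> s \<le> 1"
    if e: "e = 1 \<or> e = -1" and st: "0 < s" "s \<le> t" and sgn: "\<And>x. x > 0 \<Longrightarrow> e * growth_exponent \<phi> x \<le> 0" for e s t
  proof -
    have k: "growth_exponent \<phi> s > -1" "growth_exponent \<phi> t > -1" "\<bar>growth_exponent \<phi> s\<bar> \<le> \<bar>growth_exponent \<phi> t\<bar>"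
      using growth_exponent_gt[OF assms, of s] growth_exponent_gt[OF assms, of t] growth_exponent_abs_mono[OF assms st] st by auto
    show ?thesis using e
    proof
      assume "e = 1"
      then show ?thesis using sgn[of s] sgn[of t] k st by (auto simp: Lambda_at_def divide_simps) (auto simp: algebra_simps)?
    next
      assume "e = -1"
      then show ?thesis using sgn[of s] sgn[of t] k st by (auto simp: Lambda_at_def divide_simps) (auto simp: algebra_simps)?
    qed
  qed
  show ?thesis
  proof (cases "\<exists>x>0. growth_exponent \<phi> x > 0")
    case True
    then obtain x where x: "x > 0" "growth_exponent \<phi> x > 0" by auto
    have "growth_exponent \<phi> y \<ge> 0" if "y > 0" for y
      using growth_exponent_same_sign[OF assms, of x y] growth_exponent_same_sign[OF assms, of y x] x that
      by (cases "x \<le> y"; cases "growth_exponent \<phi> y = 0") (auto simp: zero_less_mult_iff)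
    then have k: "- 1 * growth_exponent \<phi> y \<le> 0" if "y > 0" for y using that by simp
    show ?thesis
      by (rule that[of "-1"]) (use *[of "-1", OF _ _ _ k] in \<open>auto simp: mono_on_def\<close>)
  next
    case False
    then have k: "1 * growth_exponent \<phi> y \<le> 0" if "y > 0" for y using that by force
    show ?thesis
      by (rule that[of 1]) (use *[of 1, OF _ _ _ k] in \<open>auto simp: mono_on_def\<close>)
  qed
qed

text \<open>Up to the sign \<open>e\<close> the function is monotone and bounded, so it converges as
  s tends to \<infinity>. Since \<open>Lambda_inf\<close> is a limit in t, it remains to see that
  every large t has the form s sqrt(\<phi>(s)) with s large.\<close>

lemma Lambda_at_tendsto:
  assumes adm: "admissible \<phi>"
  shows "(Lambda_at \<phi> \<longlongrightarrow> Lambda_inf \<phi>) at_top"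
proof -
  obtain e :: real where e: "e = 1 \<or> e = -1" and mono: "mono_on {0<..} (\<lambda>s. e * Lambda_at \<phi> s)"
    and e_bd: "\<And>s. s > 0 \<Longrightarrow> 0 \<le> e * Lambda_at \<phi> s" "\<And>s. s > 0 \<Longrightarrow> e * Lambda_at \<phi> s \<le> 1"
    by (rule Lambda_at_mono_sign[OF adm]) blast
  have e_mono: "e * Lambda_at \<phi> s \<le> e * Lambda_at \<phi> t" if "0 < s" "s \<le> t" for s t
    using mono_onD[OF mono, of s t] that by simp
  define L where "L = (SUP s\<in>{0<..}. e * Lambda_at \<phi> s)"
  have bdd: "bdd_above ((\<lambda>s. e * Lambda_at \<phi> s) ` {0<..})" using e_bd(2) by (intro bdd_aboveI2[of _ _ 1]) simp
  have "((\<lambda>s. e * Lambda_at \<phi> s) \<longlongrightarrow> L) at_top"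
  proof (rule increasing_tendsto)
    show "\<forall>\<^sub>F s in at_top. e * Lambda_at \<phi> s \<le> L"
      using eventually_gt_at_top[of 0] by eventually_elim (auto simp: L_def intro!: cSUP_upper bdd)
    fix x assume "x < L"
    then obtain s where s: "s > 0" "x < e * Lambda_at \<phi> s"
      unfolding L_def using less_cSUP_iff[OF _ bdd] by auto
    show "\<forall>\<^sub>F s in at_top. x < e * Lambda_at \<phi> s"
      using eventually_ge_at_top[of s] by eventually_elim (use s e_mono[of s] in \<open>meson less_le_trans\<close>)
  qed
  from tendsto_mult[OF tendsto_const[of e] this]
  have lim: "(Lambda_at \<phi> \<longlongrightarrow> e * L) at_top" using e by auto
  define T where "T s = s * sqrt (\<phi> s)" for s
  have T_sq: "(T s)\<^sup>2 = s * (s * \<phi> s)" if "s > 0" for s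
    using admissible_pos[OF adm that] by (simp add: T_def power_mult_distrib power2_eq_square)
  have T_pos: "T s > 0" if "s > 0" for s using admissible_pos[OF adm that] that by (simp add: T_def)
  have T_mono: "T a < T b" if "0 < a" "a < b" for a b
  proof -
    have "a * (a * \<phi> a) < b * (b * \<phi> b)"
      by (rule mult_strict_mono[OF that(2) admissible_strict_mono[OF adm that]])
        (use that admissible_pos[OF adm, of a] in auto)
    then have "(T a)\<^sup>2 < (T b)\<^sup>2" using that by (simp add: T_sq)
    then show ?thesis using T_pos[of b] that by (intro power2_less_imp_less[of "T a" "T b"]) auto
  qed
  have T_cont: "continuous_on {a..b} T" if "a > 0" for a b
    unfolding T_def using that
    by (intro continuous_intros continuous_on_subset[OF admissible_continuous(1)[OF adm]]) auto
  have "(Lambda \<phi> \<longlongrightarrow> e * L) at_top"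
  proof (rule tendstoI)
    fix \<epsilon> :: real assume "\<epsilon> > 0"
    from tendstoD[OF lim this] obtain s0 where s0: "\<And>s. s \<ge> s0 \<Longrightarrow> dist (Lambda_at \<phi> s) (e * L) < \<epsilon>"
      by (auto simp: eventually_at_top_linorder)
    \<comment> \<open>The bound \<open>a \<ge> 1\<close> ensures that the square of
      \<open>T b'\<close>, which is \<open>b' * (b' * \<phi> b')\<close>, is at least
      \<open>b' * \<phi> b'\<close> for \<open>b' \<ge> a\<close>.\<close>
    define a where "a = max 1 s0"
    have a: "a \<ge> 1" "a \<ge> s0" by (auto simp: a_def)
    show "\<forall>\<^sub>F t in at_top. dist (Lambda \<phi> t) (e * L) < \<epsilon>"
      unfolding eventually_at_top_linorder
    proof (intro exI[of _ "T a"] allI impI)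
      fix t assume t: "t \<ge> T a"
      then have t0: "t > 0" using T_pos[of a] a by simp
      \<comment> \<open>The surjectivity of s \<phi>(s) supplies a right end point \<open>b'\<close>
        with \<open>T b' \<ge> t\<close>; the intermediate value theorem between \<open>a\<close>
        and \<open>b'\<close> then yields \<open>s\<close> with \<open>T s = t\<close>.\<close>
      have "t\<^sup>2 \<in> (\<lambda>s. s * \<phi> s) ` {0<..}" using adm t0 by (simp add: admissible_def)
      then obtain b where b: "b > 0" "b * \<phi> b = t\<^sup>2" by auto
      define b' where "b' = max a b"
      have b': "b' \<ge> a" "b' * \<phi> b' \<ge> t\<^sup>2"
        using admissible_strict_mono[OF adm b(1), of a] b by (auto simp: b'_def max_def)
      have "t\<^sup>2 \<le> (T b')\<^sup>2"
        using b' a admissible_pos[OF adm, of b'] mult_mono[of 1 b' "t\<^sup>2" "b' * \<phi> b'"] by (simp add: T_sq)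
      moreover have "T b' > 0" by (rule T_pos) (use b' a in linarith)
      ultimately have "t \<le> T b'" by (rule power2_le_imp_le[OF _ less_imp_le])
      then have "\<exists>s\<ge>a. s \<le> b' \<and> T s = t"
        by (rule IVT'[OF t _ b'(1) T_cont]) (use a in linarith)
      then obtain s where s: "a \<le> s" "T s = t" by blast
      have "Lambda \<phi> (T s) = Lambda_at \<phi> s"
        unfolding T_def by (rule Lambda_eq_Lambda_at[OF adm]) (use s a in linarith)
      moreover have "dist (Lambda_at \<phi> s) (e * L) < \<epsilon>" by (rule s0) (use s a in linarith)
      ultimately show "dist (Lambda \<phi> t) (e * L) < \<epsilon>" by (simp add: s(2))
    qed
  qed
  then have "Lambda_inf \<phi> = e * L" by (simp add: Lambda_inf_def tendsto_Lim)
  with lim show ?thesis by simp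
qed

text \<open>With the common sign \<open>e\<close>, the function \<open>e * Lambda_at\<close> is
  non-negative and increases towards \<open>e * Lambda_inf\<close>, so \<theta> is the quotient of
  the two values. If \<open>Lambda_inf\<close> is 0, then \<open>Lambda_at\<close> vanishes and
  \<theta> = 0 serves.\<close>

lemma Lambda_at_between:
  assumes adm: "admissible \<phi>" and s: "s > 0"
  obtains \<theta> where "0 \<le> \<theta>" "\<theta> \<le> 1" "Lambda_at \<phi> s = \<theta> * Lambda_inf \<phi>"
proof -
  obtain e :: real where e: "e = 1 \<or> e = -1" and mono: "mono_on {0<..} (\<lambda>s. e * Lambda_at \<phi> s)"
    and e_bd: "\<And>s. s > 0 \<Longrightarrow> 0 \<le> e * Lambda_at \<phi> s" "\<And>s. s > 0 \<Longrightarrow> e * Lambda_at \<phi> s \<le> 1"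
    by (rule Lambda_at_mono_sign[OF adm]) blast
  have e_mono: "e * Lambda_at \<phi> s \<le> e * Lambda_at \<phi> t" if "0 < s" "s \<le> t" for s t
    using mono_onD[OF mono, of s t] that by simp
  have "((\<lambda>s. e * Lambda_at \<phi> s) \<longlongrightarrow> e * Lambda_inf \<phi>) at_top"
    by (intro tendsto_intros Lambda_at_tendsto adm)
  moreover have "eventually (\<lambda>t. e * Lambda_at \<phi> s \<le> e * Lambda_at \<phi> t) at_top"
    using eventually_ge_at_top[of s] by eventually_elim (use e_mono[of s] s in blast)
  ultimately have le: "e * Lambda_at \<phi> s \<le> e * Lambda_inf \<phi>"
    by (rule tendsto_lowerbound) simp
  have ge: "0 \<le> e * Lambda_at \<phi> s" using e_bd(1)[OF s] .
  show ?thesis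
  proof (cases "Lambda_inf \<phi> = 0")
    case True
    then show ?thesis using le ge e that[of 0] by auto
  next
    case False
    then show ?thesis using le ge e that[of "Lambda_at \<phi> s / Lambda_inf \<phi>"]
      by (auto simp: divide_simps split: if_splits)
  qed
qed

section \<open>The quadratic form\<close>

text \<open>Only real parts enter the condition, so the computations can be done in the underlying
  real inner product space.\<close>

lemma Re_cdot: "Re (cdot v w) = inner v w"
  by (simp add: cdot_def inner_vec_def inner_complex_def)

lemma matrix_vector_mult_scaleR_right:
  fixes B :: "complex ^ 'm ^ 'm"
  shows "B *v (c *\<^sub>R v) = c *\<^sub>R (B *v v)"
  by (simp add: vec_eq_iff matrix_vector_mult_def scaleR_sum_right)

text \<open>The condition of the theorem at one point and for one direction, with a free real number
  \<open>L\<close> so that it can be compared for different values of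
  \<open>Lambda_at\<close>.\<close>

definition form_nonneg :: "complex ^ 'm ^ 'm \<Rightarrow> real \<Rightarrow> bool" where
  "form_nonneg B L \<longleftrightarrow> (\<forall>l \<omega>. norm \<omega> = 1 \<longrightarrow>
        Re (cdot (B *v l) l)
        - L\<^sup>2 * Re (cdot (B *v \<omega>) \<omega>) * (Re (cdot l \<omega>))\<^sup>2
        + L * Re (cdot (B *v \<omega>) l - cdot (B *v l) \<omega>) * Re (cdot l \<omega>)
        \<ge> 0)"

text \<open>Multiplication by the imaginary unit turns \<open>l\<close> into a vector orthogonal to
  it in the real inner product; this works in dimension one as well.\<close>

lemma exists_unit_orthogonal:
  fixes l :: "complex ^ 'm"
  assumes "l \<noteq> 0"
  obtains \<omega> where "norm \<omega> = 1" "inner l \<omega> = 0"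
proof -
  define z where "z = (\<chi> j. \<i> * l $ j)"
  have "norm z = norm l" by (simp add: z_def norm_vec_def norm_mult)
  moreover have "inner l z = 0" by (simp add: z_def inner_vec_def inner_complex_def algebra_simps)
  ultimately show ?thesis using that[of "z /\<^sub>R norm l"] assms by simp
qed

text \<open>Choosing \<omega> orthogonal to \<open>l\<close> removes every term containing Re
  \<langle>l, \<omega>\<rangle>.\<close>

lemma form_nonneg_diag:
  fixes B :: "complex ^ 'm ^ 'm"
  assumes "form_nonneg B L"
  shows "inner (B *v l) l \<ge> 0"
proof (cases "l = 0")
  case False
  obtain \<omega> where "norm \<omega> = 1" "inner l \<omega> = 0" by (rule exists_unit_orthogonal[OF False])
  with assms[unfolded form_nonneg_def, rule_format, of \<omega> l] show ?thesis by (simp add: Re_cdot)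
qed simp

text \<open>Concavity in \<open>L\<close>, made explicit: the value at \<open>\<theta> * L\<close>
  is the convex combination of the values at 0 and at \<open>L\<close>, plus \<theta> (1 - \<theta>)
  L^2 t^2 b. The values \<open>a\<close> and \<open>b\<close> are non-negative by
  \<open>form_nonneg_diag\<close>.\<close>

lemma form_nonneg_scale:
  fixes B :: "complex ^ 'm ^ 'm"
  assumes "form_nonneg B L" "0 \<le> \<theta>" "\<theta> \<le> 1"
  shows "form_nonneg B (\<theta> * L)"
  unfolding form_nonneg_def
proof (intro allI impI)
  fix l \<omega> :: "complex ^ 'm" assume \<omega>: "norm \<omega> = 1"
  define a b c t where "a = Re (cdot (B *v l) l)" "b = Re (cdot (B *v \<omega>) \<omega>)"
    "c = Re (cdot (B *v \<omega>) l - cdot (B *v l) \<omega>)" "t = Re (cdot l \<omega>)"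
  have "a \<ge> 0" "b \<ge> 0" using form_nonneg_diag[OF assms(1)] by (simp_all add: a_b_c_t_def Re_cdot)
  moreover have "a - L\<^sup>2 * b * t\<^sup>2 + L * c * t \<ge> 0"
    using assms(1) \<omega> by (simp add: form_nonneg_def a_b_c_t_def)
  ultimately have "(1 - \<theta>) * a \<ge> 0" "\<theta> * (a - L\<^sup>2 * b * t\<^sup>2 + L * c * t) \<ge> 0" "\<theta> * (1 - \<theta>) * ((L * t)\<^sup>2 * b) \<ge> 0"
    using assms(2,3) by (simp_all only: mult_nonneg_nonneg diff_ge_0_iff_ge zero_le_power2)
  then have "(1 - \<theta>) * a + \<theta> * (a - L\<^sup>2 * b * t\<^sup>2 + L * c * t) + \<theta> * (1 - \<theta>) * ((L * t)\<^sup>2 * b) \<ge> 0"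
    by linarith
  also have "\<dots> = a - (\<theta> * L)\<^sup>2 * b * t\<^sup>2 + (\<theta> * L) * c * t"
    by (simp add: power2_eq_square algebra_simps)
  finally show "0 \<le> Re (cdot (B *v l) l) - (\<theta> * L)\<^sup>2 * Re (cdot (B *v \<omega>) \<omega>) * (Re (cdot l \<omega>))\<^sup>2
      + (\<theta> * L) * Re (cdot (B *v \<omega>) l - cdot (B *v l) \<omega>) * Re (cdot l \<omega>)"
    by (simp only: a_b_c_t_def)
qed

lemma dPhi_unit:
  fixes \<omega> :: "'a::real_inner"
  assumes "admissible \<phi>" "s > 0" "norm \<omega> = 1"
  shows "dPhi \<phi> (s *\<^sub>R \<omega>) p = \<phi> s *\<^sub>R (p + (growth_exponent \<phi> s * inner p \<omega>) *\<^sub>R \<omega>)"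
  using admissible_pos[OF assms(1,2)] assms(2,3)
  by (simp add: dPhi_def growth_exponent_def scaleR_add_right mult_ac)

text \<open>\<open>L\<close> solves L (\<kappa> + 2) = -\<kappa> for the growth exponent \<kappa>.
  With this choice \<open>dPhi\<close> sends l + L t \<omega> to \<phi>(s) (l - L t \<omega>), where
  t is the inner product of \<open>l\<close> and \<omega>, and expanding the product of the two
  gives the form of the theorem.\<close>

lemma form_eq:
  fixes B :: "complex ^ 'm ^ 'm"
  assumes adm: "admissible \<phi>" and s: "s > 0" and \<omega>: "norm \<omega> = 1" and L: "L = Lambda_at \<phi> s"
  shows "inner (B *v (l + (L * inner l \<omega>) *\<^sub>R \<omega>)) (dPhi \<phi> (s *\<^sub>R \<omega>) (l + (L * inner l \<omega>) *\<^sub>R \<omega>)) =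
    \<phi> s * (Re (cdot (B *v l) l) - L\<^sup>2 * Re (cdot (B *v \<omega>) \<omega>) * (Re (cdot l \<omega>))\<^sup>2
        + L * Re (cdot (B *v \<omega>) l - cdot (B *v l) \<omega>) * Re (cdot l \<omega>))"
proof -
  define t where "t = inner l \<omega>"
  define p where "p = l + (L * t) *\<^sub>R \<omega>"
  have \<omega>\<omega>: "inner \<omega> \<omega> = 1" using \<omega> by (simp add: dot_square_norm)
  have k: "growth_exponent \<phi> s > -1" using growth_exponent_gt[OF adm s] .
  have "inner p \<omega> = (1 + L) * t" by (simp add: p_def inner_add_left \<omega>\<omega> t_def algebra_simps)
  moreover have "L * (growth_exponent \<phi> s + 2) = - growth_exponent \<phi> s" using k by (simp add: L Lambda_at_def)
  then have "growth_exponent \<phi> s * (1 + L) = - L - L" by (simp add: algebra_simps)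
  \<comment> \<open>The value is -2 L t, so the coefficient of \<omega> in \<open>dPhi\<close>
    becomes L t - 2 L t = - L t.\<close>
  ultimately have k2: "growth_exponent \<phi> s * inner p \<omega> = - (L * t) - L * t"
    by (metis mult.assoc left_diff_distrib mult_minus_left)
  have e1: "dPhi \<phi> (s *\<^sub>R \<omega>) p = \<phi> s *\<^sub>R (l - (L * t) *\<^sub>R \<omega>)"
    unfolding dPhi_unit[OF adm s \<omega>] k2
    unfolding p_def scaleR_diff_left scaleR_minus_left by simp
  have e2: "B *v p = B *v l + (L * t) *\<^sub>R (B *v \<omega>)"
    by (simp add: p_def matrix_vector_right_distrib matrix_vector_mult_scaleR_right)
  show ?thesis
    unfolding t_def[symmetric] p_def[symmetric] e1 e2
    by (simp add: Re_cdot t_def[symmetric] inner_add_left inner_diff_right power2_eq_square algebra_simps)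
qed

text \<open>The substitution of \<open>form_eq\<close> is a bijection of \<open>l\<close> and
  \<open>p\<close> for each \<omega>, because 1 + L = 2 / (\<kappa> + 2) is positive for the growth
  exponent \<kappa>.\<close>

lemma form_nonneg_Lambda_at_iff:
  fixes B :: "complex ^ 'm ^ 'm"
  assumes adm: "admissible \<phi>" and s: "s > 0"
  shows "form_nonneg B (Lambda_at \<phi> s) \<longleftrightarrow> (\<forall>p \<omega>. norm \<omega> = 1 \<longrightarrow> inner (B *v p) (dPhi \<phi> (s *\<^sub>R \<omega>) p) \<ge> 0)"
proof (intro iffI allI impI)
  fix p \<omega> :: "complex ^ 'm" assume form_nonneg: "form_nonneg B (Lambda_at \<phi> s)" and \<omega>: "norm \<omega> = 1"
  have \<omega>\<omega>: "inner \<omega> \<omega> = 1" using \<omega> by (simp add: dot_square_norm)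
  define L where "L = Lambda_at \<phi> s"
  have L: "1 + L > 0" using growth_exponent_gt[OF adm s] by (simp add: L_def Lambda_at_def field_simps)
  \<comment> \<open>The inverse substitution: pairing p = l + L \<langle>l, \<omega>\<rangle>
    \<omega> with \<omega> gives \<langle>l, \<omega>\<rangle> = \<langle>p, \<omega>\<rangle> / (1
    + L).\<close>
  define l where "l = p - (L * inner p \<omega> / (1 + L)) *\<^sub>R \<omega>"
  have "inner l \<omega> = inner p \<omega> / (1 + L)"
    using L by (simp add: l_def inner_diff_left \<omega>\<omega> field_simps)
  then have p: "p = l + (L * inner l \<omega>) *\<^sub>R \<omega>" by (simp add: l_def)
  show "inner (B *v p) (dPhi \<phi> (s *\<^sub>R \<omega>) p) \<ge> 0"
    unfolding p form_eq[OF adm s \<omega> L_def]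
    using form_nonneg[folded L_def] \<omega> admissible_pos[OF adm s] by (simp add: form_nonneg_def)
next
  assume *: "\<forall>p \<omega>. norm \<omega> = 1 \<longrightarrow> inner (B *v p) (dPhi \<phi> (s *\<^sub>R \<omega>) p) \<ge> 0"
  show "form_nonneg B (Lambda_at \<phi> s)"
    unfolding form_nonneg_def
  proof (intro allI impI)
    fix l \<omega> :: "complex ^ 'm" assume \<omega>: "norm \<omega> = 1"
    from *[rule_format, OF \<omega>, of "l + (Lambda_at \<phi> s * inner l \<omega>) *\<^sub>R \<omega>"]
    show "0 \<le> Re (cdot (B *v l) l) - (Lambda_at \<phi> s)\<^sup>2 * Re (cdot (B *v \<omega>) \<omega>) * (Re (cdot l \<omega>))\<^sup>2
      + Lambda_at \<phi> s * Re (cdot (B *v \<omega>) l - cdot (B *v l) \<omega>) * Re (cdot l \<omega>)"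
      unfolding form_eq[OF adm s \<omega> refl]
      using admissible_pos[OF adm s] by (simp only: zero_le_mult_iff) auto
  qed
qed

section \<open>Behaviour at the zeros of a test function\<close>

lemma has_real_derivative_line_inner:
  fixes f :: "real ^ 'n \<Rightarrow> 'b::real_inner"
  assumes "f differentiable (at x)"
  shows "((\<lambda>t. inner (f (x + t *\<^sub>R axis h 1)) q) has_real_derivative inner (pderiv_dir h f x) q) (at 0)"
proof -
  have "(f has_derivative frechet_derivative f (at x)) (at (x + 0 *\<^sub>R axis h 1))"
    using assms by (simp add: frechet_derivative_works)
  moreover have "((\<lambda>t::real. x + t *\<^sub>R axis h 1) has_derivative (\<lambda>t. t *\<^sub>R axis h 1)) (at 0)"
    by (auto intro!: derivative_eq_intros)
  ultimately have "((\<lambda>t. f (x + t *\<^sub>R axis h 1)) has_derivative (\<lambda>t. frechet_derivative f (at x) (t *\<^sub>R axis h 1))) (at 0)"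
    by (rule has_derivative_compose[rotated])
  from has_derivative_inner_left[OF this, of q]
  show ?thesis
    unfolding has_field_derivative_def
    by (rule has_derivative_eq_rhs)
      (simp add: fun_eq_iff pderiv_dir_def linear_scale[OF linear_frechet_derivative[OF assms]] mult.commute)
qed

text \<open>Along the line through \<open>x\<close> in direction \<open>h\<close>, the two difference quotients differ by the factor
  \<open>\<phi>(|u|)\<close>, which therefore converges.\<close>

lemma pderiv_dir_Phi_zero:
  fixes u :: "real ^ 'n \<Rightarrow> 'b::real_inner"
  assumes adm: "admissible \<phi>" and u: "u differentiable (at x)"
    and V: "(\<lambda>x. \<phi> (norm (u x)) *\<^sub>R u x) differentiable (at x)" and 0: "u x = 0"
    and p: "pderiv_dir h u x \<noteq> 0"
  obtains c where "c \<ge> 0" "pderiv_dir h (\<lambda>x. \<phi> (norm (u x)) *\<^sub>R u x) x = c *\<^sub>R pderiv_dir h u x"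
proof -
  define p where "p = pderiv_dir h u x"
  define P where "P = pderiv_dir h (\<lambda>x. \<phi> (norm (u x)) *\<^sub>R u x) x"
  define w where "w t = u (x + t *\<^sub>R axis h 1)" for t
  define \<rho> where "\<rho> t = \<phi> (norm (w t))" for t
  have u_lim: "((\<lambda>t. inner (w t) q / t) \<longlongrightarrow> inner p q) (at 0)" for q
    using has_real_derivative_line_inner[OF u, of h q] by (simp add: DERIV_def 0 w_def p_def)
  have V_lim: "((\<lambda>t. \<rho> t * (inner (w t) q / t)) \<longlongrightarrow> inner P q) (at 0)" for q
    using has_real_derivative_line_inner[OF V, of h q] by (simp add: DERIV_def 0 w_def P_def \<rho>_def)
  have pp: "inner p p > 0" using p by (simp add: p_def)
  have pos: "eventually (\<lambda>t. inner (w t) p / t > 0) (at 0)"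
    using order_tendstoD(1)[OF u_lim pp] .
  \<comment> \<open>The future limit of \<rho>: both difference quotients are tested against
    \<open>p\<close>, and the one in the denominator tends to |p|^2 > 0. In particular
    \<open>w t\<close> is non-zero for small t \<noteq> 0, so the value \<phi>(0) does not
    enter.\<close>
  define c where "c = inner P p / inner p p"
  have "((\<lambda>t. (\<rho> t * (inner (w t) p / t)) / (inner (w t) p / t)) \<longlongrightarrow> c) (at 0)"
    unfolding c_def by (intro tendsto_divide u_lim V_lim) (use pp in auto)
  then have \<rho>: "(\<rho> \<longlongrightarrow> c) (at 0)"
  proof (rule Lim_transform_eventually)
    show "eventually (\<lambda>t. \<rho> t * (inner (w t) p / t) / (inner (w t) p / t) = \<rho> t) (at 0)"
      using pos
    proof eventually_elim
      case (elim t)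
      then have "t \<noteq> 0" "inner (w t) p \<noteq> 0" by auto
      then show ?case by simp
    qed
  qed
  have "eventually (\<lambda>t. \<rho> t \<ge> 0) (at 0)"
    using pos
  proof eventually_elim
    case (elim t)
    then have "w t \<noteq> 0" by auto
    then show ?case using admissible_pos[OF adm, of "norm (w t)"] by (simp add: \<rho>_def)
  qed
  then have c: "c \<ge> 0" using \<rho> by (intro tendsto_lowerbound[OF \<rho>]) auto
  have "inner P q = inner (c *\<^sub>R p) q" for q
    using tendsto_unique[OF _ V_lim[of q] tendsto_mult[OF \<rho> u_lim[of q]]] by simp
  then have "P = c *\<^sub>R p" by (metis inner_commute vector_eq_ldot)
  with c show ?thesis using that by (simp add: P_def p_def)
qed

section \<open>Testing the sign of a locally integrable function\<close>

text \<open>A compact set on which \<open>q\<close> is negative must be null, since the integral of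
  \<open>q\<close> over it is non-negative. Inside each of countably many compact sets covering
  \<open>S\<close>, the set where \<open>q\<close> is negative is, up to a null set, a countable
  union of such compact sets.\<close>

lemma AE_nonneg_of_compact_integrals:
  fixes q :: "'a::euclidean_space \<Rightarrow> real"
  assumes S: "open S" and int: "\<And>K. compact K \<Longrightarrow> K \<subseteq> S \<Longrightarrow> set_integrable lebesgue K q"
    and nonneg: "\<And>K. compact K \<Longrightarrow> K \<subseteq> S \<Longrightarrow> 0 \<le> (LINT x:K|lebesgue. q x)"
  shows "AE x in lebesgue. x \<in> S \<longrightarrow> q x \<ge> 0"
proof -
  have null: "K \<in> null_sets lebesgue" if K: "compact K" "K \<subseteq> S" "\<And>x. x \<in> K \<Longrightarrow> q x < 0" for K
  proof -
    have i: "integrable lebesgue (\<lambda>x. - (indicator K x *\<^sub>R q x))"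
      using int[OF K(1,2)] by (simp add: set_integrable_def)
    have ge: "AE x in lebesgue. 0 \<le> - (indicator K x *\<^sub>R q x)"
      using K(3) by (auto simp: indicator_def less_imp_le)
    have "integral\<^sup>L lebesgue (\<lambda>x. - (indicator K x *\<^sub>R q x)) \<le> 0"
      using nonneg[OF K(1,2)] by (simp add: set_lebesgue_integral_def)
    with integral_nonneg_AE[OF ge] integral_nonneg_eq_0_iff_AE[OF i ge]
    have "AE x in lebesgue. - (indicator K x *\<^sub>R q x) = 0" by simp
    then have "AE x in lebesgue. x \<notin> K"
      by eventually_elim (use K(3) in \<open>force simp: indicator_def\<close>)
    moreover have "K \<in> sets lebesgue" using K(1) by (simp add: borel_compact)
    ultimately show ?thesis by (simp add: AE_iff_null_sets)
  qed
  obtain C :: "nat \<Rightarrow> 'a set" where C: "\<And>n. compact (C n)" "\<And>n. C n \<subseteq> S" "\<Union>(range C) = S"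
    using open_Union_compact_subsets[OF S] by metis
  have "{x \<in> C n. q x < 0} \<in> null_sets lebesgue" for n
  proof -
    have "(\<lambda>x. indicator (C n) x *\<^sub>R q x) \<in> borel_measurable lebesgue"
      using int[OF C(1,2)] by (auto simp: set_integrable_def)
    from measurable_sets[OF this, of "{..<0}"]
    have "(\<lambda>x. indicator (C n) x *\<^sub>R q x) -` {..<0} \<in> sets lebesgue" by simp
    moreover have "(\<lambda>x. indicator (C n) x *\<^sub>R q x) -` {..<0} = {x \<in> C n. q x < 0}"
      by (auto simp: indicator_def of_bool_def split: if_splits)
    ultimately obtain F T where FT: "fsigma F" "T \<in> null_sets lebesgue" "F \<union> T = {x \<in> C n. q x < 0}"
      using lebesgue_set_almost_fsigma by metis
    then obtain G :: "nat \<Rightarrow> 'a set" where G: "range G \<subseteq> Collect compact" "F = \<Union>(range G)"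
      by (auto simp: fsigma_Union_compact)
    have "G i \<in> null_sets lebesgue" for i
    proof (rule null)
      have "G i \<subseteq> {x \<in> C n. q x < 0}" using FT(3) G(2) by blast
      then show "G i \<subseteq> S" "\<And>x. x \<in> G i \<Longrightarrow> q x < 0" using C(2)[of n] by auto
    qed (use G(1) in auto)
    then have "F \<in> null_sets lebesgue" unfolding G(2) by (rule null_sets_UN)
    with FT(2,3) show ?thesis by (metis null_sets.Un)
  qed
  then have "(\<Union>n. {x \<in> C n. q x < 0}) \<in> null_sets lebesgue" by (rule null_sets_UN)
  then show ?thesis by (rule AE_I') (use C(3) in force)
qed

text \<open>Squares of cutoffs that are 1 on \<open>K\<close>, with supports shrinking to
  \<open>K\<close>, converge pointwise to the indicator of \<open>K\<close>; dominated convergence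
  carries the test inequality over to the integral on \<open>K\<close>.\<close>

lemma compact_integral_nonneg_of_C1_tests:
  fixes q :: "real ^ 'n \<Rightarrow> real"
  assumes S: "open S" and int: "\<And>K. compact K \<Longrightarrow> K \<subseteq> S \<Longrightarrow> set_integrable lebesgue K q"
    and test: "\<And>\<eta>. C1_on UNIV \<eta> \<Longrightarrow> compact (closure {x. \<eta> x \<noteq> 0}) \<Longrightarrow> closure {x. \<eta> x \<noteq> 0} \<subseteq> S \<Longrightarrow>
      0 \<le> (LINT x:S|lebesgue. (\<eta> x)\<^sup>2 * q x)"
    and K: "compact K" "K \<subseteq> S"
  shows "0 \<le> (LINT x:K|lebesgue. q x)"
\<comment> \<open>The empty set is split off because \<open>infdist x {}\<close> is 0 by convention,
  while below the distance to \<open>K\<close> has to be positive off \<open>K\<close>.\<close>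
proof (cases "K = {}")
  case False
  obtain \<psi> :: "real ^ 'n \<Rightarrow> real" where \<psi>: "C1_on UNIV \<psi>" "\<And>x. x \<in> K \<Longrightarrow> \<psi> x = 1"
      "compact (closure {x. \<psi> x \<noteq> 0})" "closure {x. \<psi> x \<noteq> 0} \<subseteq> S"
    using C1_Urysohn[OF K(1) S K(2)] by metis
  define K1 where "K1 = closure {x. \<psi> x \<noteq> 0}"
  \<comment> \<open>Neighbourhoods shrinking to \<open>K\<close>, all inside the support
    \<open>K1\<close> of a single cutoff, so that the absolute value of \<open>q\<close> on
    \<open>K1\<close> is a common integrable majorant.\<close>
  define U where "U j = {x. \<psi> x \<noteq> 0} \<inter> {x. infdist x K < 1 / real (Suc j)}" for j
  have openU: "open (U j)" for j
    unfolding U_def using \<psi>(1)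
    by (intro open_Int open_Collect_neq open_Collect_less continuous_intros C1_on_continuous)
  have KU: "K \<subseteq> U j" for j using \<psi>(2) by (auto simp: U_def)
  have "\<exists>\<eta>. C1_on UNIV \<eta> \<and> (\<forall>x. 0 \<le> \<eta> x \<and> \<eta> x \<le> 1) \<and> (\<forall>x\<in>K. \<eta> x = (1::real)) \<and>
      compact (closure {x. \<eta> x \<noteq> 0}) \<and> closure {x. \<eta> x \<noteq> 0} \<subseteq> U j" for j
    by (rule C1_Urysohn[OF K(1) openU[of j] KU[of j]]) blast
  then have "\<exists>\<eta>. \<forall>j. C1_on UNIV (\<eta> j) \<and> (\<forall>x. 0 \<le> \<eta> j x \<and> \<eta> j x \<le> 1) \<and> (\<forall>x\<in>K. \<eta> j x = (1::real)) \<and>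
      compact (closure {x. \<eta> j x \<noteq> 0}) \<and> closure {x. \<eta> j x \<noteq> 0} \<subseteq> U j"
    by (intro choice allI)
  then obtain \<eta> where "\<forall>j. C1_on UNIV (\<eta> j) \<and> (\<forall>x. 0 \<le> \<eta> j x \<and> \<eta> j x \<le> 1) \<and> (\<forall>x\<in>K. \<eta> j x = (1::real)) \<and>
      compact (closure {x. \<eta> j x \<noteq> 0}) \<and> closure {x. \<eta> j x \<noteq> 0} \<subseteq> U j"
    by (elim exE)
  then have \<eta>: "\<And>j. C1_on UNIV (\<eta> j)" "\<And>j x. 0 \<le> \<eta> j x" "\<And>j x. \<eta> j x \<le> 1"
      "\<And>j x. x \<in> K \<Longrightarrow> \<eta> j x = 1" "\<And>j. compact (closure {x. \<eta> j x \<noteq> 0})" "\<And>j. closure {x. \<eta> j x \<noteq> 0} \<subseteq> U j"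
    by simp_all
  have K1: "compact K1" "K1 \<subseteq> S" "\<And>j. U j \<subseteq> K1"
    using \<psi>(3,4) closure_subset[of "{x. \<psi> x \<noteq> 0}"] by (auto simp: K1_def U_def)
  have zero: "\<eta> j x = 0" if "x \<notin> U j" for j x
    using \<eta>(6)[of j] closure_subset[of "{x. \<eta> j x \<noteq> 0}"] that by auto
  have q: "integrable lebesgue (\<lambda>x. indicator K1 x *\<^sub>R q x)"
    using int[OF K1(1,2)] by (simp add: set_integrable_def)
  have eq: "indicator S x *\<^sub>R ((\<eta> j x)\<^sup>2 * q x) = (\<eta> j x)\<^sup>2 * (indicator K1 x *\<^sub>R q x)" for j x
    using zero[of x j] K1(2) K1(3)[of j] by (auto simp: indicator_def)
  have "(\<lambda>j. integral\<^sup>L lebesgue (\<lambda>x. indicator S x *\<^sub>R ((\<eta> j x)\<^sup>2 * q x))) \<longlonglongrightarrow>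
      integral\<^sup>L lebesgue (\<lambda>x. indicator K x *\<^sub>R q x)"
    unfolding eq
  proof (rule integral_dominated_convergence)
    show "(\<lambda>x. indicator K x *\<^sub>R q x) \<in> borel_measurable lebesgue"
      using int[OF K] by (auto simp: set_integrable_def)
    show "(\<lambda>x. (\<eta> j x)\<^sup>2 * (indicator K1 x *\<^sub>R q x)) \<in> borel_measurable lebesgue" for j
    proof -
      have "\<eta> j \<in> borel_measurable lebesgue"
        using borel_measurable_continuous_onI[OF C1_on_continuous[OF \<eta>(1)]] by (simp add: measurable_completion)
      then show ?thesis using q by (intro borel_measurable_times borel_measurable_power) auto
    qed
    show "integrable lebesgue (\<lambda>x. \<bar>indicator K1 x *\<^sub>R q x\<bar>)" using q by (rule integrable_abs)
    have "(\<lambda>j. (\<eta> j x)\<^sup>2 * (indicator K1 x *\<^sub>R q x)) \<longlonglongrightarrow> indicator K x *\<^sub>R q x" for x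
    proof (cases "x \<in> K")
      case True
      then have "x \<in> K1" using KU K1(3) by blast
      then show ?thesis using True \<eta>(4) by simp
    next
      case x: False
      then have "infdist x K > 0"
        using K(1) False infdist_pos_not_in_closed[of K x] by (simp add: compact_imp_closed)
      then obtain N where N: "1 / real (Suc N) < infdist x K" by (rule nat_approx_posE)
      have "eventually (\<lambda>j. \<eta> j x = 0) sequentially"
        unfolding eventually_sequentially
      proof (intro exI[of _ N] allI impI zero)
        fix j assume "N \<le> j"
        then have "1 / real (Suc j) \<le> 1 / real (Suc N)" by (simp add: field_simps)
        then show "x \<notin> U j" using N by (simp add: U_def)
      qed
      then have "eventually (\<lambda>j. (\<eta> j x)\<^sup>2 * (indicator K1 x *\<^sub>R q x) = 0) sequentially"
        by eventually_elim simp
      then show ?thesis using x by (simp add: tendsto_eventually)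
    qed
    then show "AE x in lebesgue. (\<lambda>j. (\<eta> j x)\<^sup>2 * (indicator K1 x *\<^sub>R q x)) \<longlonglongrightarrow> indicator K x *\<^sub>R q x" by simp
    have "(\<eta> j x)\<^sup>2 \<le> 1" for j x using \<eta>(2,3) by (simp add: power_le_one)
    then show "AE x in lebesgue. norm ((\<eta> j x)\<^sup>2 * (indicator K1 x *\<^sub>R q x)) \<le> \<bar>indicator K1 x *\<^sub>R q x\<bar>" for j
      by (auto simp: abs_mult intro!: AE_I2 mult_left_le_one_le)
  qed
  moreover have "0 \<le> integral\<^sup>L lebesgue (\<lambda>x. indicator S x *\<^sub>R ((\<eta> j x)\<^sup>2 * q x))" for j
    using test[OF \<eta>(1,5), of j] \<eta>(6)[of j] K1(2) K1(3)[of j] unfolding set_lebesgue_integral_def by blast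
  ultimately show ?thesis
    unfolding set_lebesgue_integral_def by (intro tendsto_lowerbound) auto
qed (simp add: set_lebesgue_integral_def)

section \<open>Oscillating test functions\<close>

lemma C1_on_compact_support_bounded:
  fixes f :: "real ^ 'n \<Rightarrow> real"
  assumes f: "C1_on UNIV f" and K: "compact K" "{x. f x \<noteq> 0} \<subseteq> K"
  obtains C where "C \<ge> 0" "\<And>x. \<bar>f x\<bar> \<le> C" "\<And>k x. \<bar>pderiv_dir k f x\<bar> \<le> C"
proof -
  have "bounded (f ` K)" "\<And>k. bounded (pderiv_dir k f ` K)"
    using K(1) C1_on_continuous[OF f] C1_on_pderiv_dir[OF f]
    by (auto intro!: compact_imp_bounded compact_continuous_image intro: continuous_on_subset[OF _ subset_UNIV])
  then have "\<exists>a. \<forall>x\<in>K. \<bar>f x\<bar> \<le> a" "\<forall>k. \<exists>b. \<forall>x\<in>K. \<bar>pderiv_dir k f x\<bar> \<le> b"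
    by (simp_all add: bounded_iff)
  then obtain a b where a: "\<And>x. x \<in> K \<Longrightarrow> \<bar>f x\<bar> \<le> a" and b: "\<And>k x. x \<in> K \<Longrightarrow> \<bar>pderiv_dir k f x\<bar> \<le> b k"
    by metis
  have cl: "closure {x. f x \<noteq> 0} \<subseteq> K" using K by (simp add: closure_minimal compact_imp_closed)
  \<comment> \<open>Summing over the finitely many directions gives one constant for all partial
    derivatives.\<close>
  define C where "C = \<bar>a\<bar> + (\<Sum>k\<in>UNIV. \<bar>b k\<bar>)"
  have Cb: "\<bar>b k\<bar> \<le> C" for k
    using member_le_sum[of k UNIV "\<lambda>k. \<bar>b k\<bar>"] by (simp add: C_def)
  show ?thesis
  proof
    show C0: "C \<ge> 0" by (simp add: C_def sum_nonneg)
    show "\<bar>f x\<bar> \<le> C" for x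
    proof (cases "x \<in> K")
      case True
      moreover have "0 \<le> (\<Sum>k\<in>UNIV. \<bar>b k\<bar>)" by (simp add: sum_nonneg)
      ultimately show ?thesis using a[of x] unfolding C_def by linarith
    next
      case False
      then have "f x = 0" using K(2) by auto
      then show ?thesis using C0 by simp
    qed
    show "\<bar>pderiv_dir k f x\<bar> \<le> C" for k x
    proof (cases "x \<in> K")
      case True
      then show ?thesis using b[of x k] Cb[of k] by simp
    next
      case False
      then have "x \<notin> closure {x. f x \<noteq> 0}" using cl by blast
      then show ?thesis using pderiv_dir_eq_0_outside_support[of x f k] C0 by simp
    qed
  qed
qed

lemma C10_I:
  assumes "C1_on UNIV u" "compact K" "K \<subseteq> \<Omega>" "{x. u x \<noteq> 0} \<subseteq> K"
  shows "u \<in> C10 \<Omega>"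
proof -
  have cl: "closure {x \<in> \<Omega>. u x \<noteq> 0} \<subseteq> K"
    using assms by (intro closure_minimal) (auto simp: compact_imp_closed)
  then have "compact (closure {x \<in> \<Omega>. u x \<noteq> 0})"
    by (metis Int_absorb1 assms(2) closed_closure compact_Int_closed)
  with cl assms(3) C1_on_subset[OF assms(1), of \<Omega>] show ?thesis
    by (auto simp: C10_def C1_on_def)
qed

lemma pderiv_dir_scaleR_const:
  assumes "f differentiable (at x)"
  shows "pderiv_dir k (\<lambda>x. f x *\<^sub>R v) x = pderiv_dir k f x *\<^sub>R v"
  using pderiv_dir_scaleR[OF assms, of "\<lambda>_. v"] by simp

text \<open>Amplitude 1/N and frequency N^2 make the perturbation of \<open>v\<close> tend to 0
  while its derivative in direction \<open>h\<close> has size N; the other derivatives stay bounded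
  and disappear after division by N. The normalised derivatives keep oscillating, so the conclusion
  compares them with explicit oscillating multiples of \<open>p\<close> and
  \<open>dPhi \<phi> v p\<close>. The bounds by \<open>C * N n\<close> prepare dominated
  convergence.\<close>

lemma oscillating_test_functions:
  fixes \<phi> :: "real \<Rightarrow> real" and \<Omega> :: "(real ^ 'n) set" and v p :: "complex ^ 'm"
    and \<eta> :: "real ^ 'n \<Rightarrow> real" and n0 :: nat and \<sigma> \<sigma>' :: "real \<Rightarrow> real" and h :: 'n
  defines "N \<equiv> \<lambda>n. real (n + n0)"
  assumes adm: "admissible \<phi>" and v: "v \<noteq> 0" and \<Omega>: "open \<Omega>"
    and \<eta>: "C1_on UNIV \<eta>" "compact (closure {x. \<eta> x \<noteq> 0})" "closure {x. \<eta> x \<noteq> 0} \<subseteq> \<Omega>"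
    and n0: "n0 \<ge> 1" "\<And>x. \<bar>\<eta> x\<bar> * norm p \<le> n0 * (norm v / 2)"
    and \<sigma>: "\<And>t. (\<sigma> has_real_derivative \<sigma>' t) (at t)" "continuous_on UNIV \<sigma>'"
      "\<And>t. \<bar>\<sigma> t\<bar> \<le> 1" "\<And>t. \<bar>\<sigma>' t\<bar> \<le> 1"
  obtains K C and u :: "nat \<Rightarrow> real ^ 'n \<Rightarrow> complex ^ 'm"
  where "compact K" "K \<subseteq> \<Omega>" "C \<ge> 0"
    "\<And>n. u n \<in> C10 \<Omega>" "\<And>n. (\<lambda>x. \<phi> (norm (u n x)) *\<^sub>R u n x) \<in> C10 \<Omega>"
    "\<And>n k x. x \<notin> K \<Longrightarrow> pderiv_dir k (u n) x = 0"
    "\<And>n k x. norm (pderiv_dir k (u n) x) \<le> C * N n"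
    "\<And>n k x. norm (pderiv_dir k (\<lambda>x. \<phi> (norm (u n x)) *\<^sub>R u n x) x) \<le> C * N n"
    "\<And>k x. (\<lambda>n. (1 / N n) *\<^sub>R pderiv_dir k (u n) x
        - (if k = h then \<eta> x * \<sigma>' ((N n)\<^sup>2 * x $ h) else 0) *\<^sub>R p) \<longlonglongrightarrow> 0"
    "\<And>k x. (\<lambda>n. (1 / N n) *\<^sub>R pderiv_dir k (\<lambda>x. \<phi> (norm (u n x)) *\<^sub>R u n x) x
        - (if k = h then \<eta> x * \<sigma>' ((N n)\<^sup>2 * x $ h) else 0) *\<^sub>R dPhi \<phi> v p) \<longlonglongrightarrow> 0"
proof -
  define K' where "K' = closure {x. \<eta> x \<noteq> 0}"
  have \<eta>0: "\<eta> x = 0" if "x \<notin> K'" for x using that closure_subset[of "{x. \<eta> x \<noteq> 0}"] by (auto simp: K'_def)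
  have K': "compact K'" "K' \<subseteq> \<Omega>" "closed K'" using \<eta> by (auto simp: K'_def)
  obtain \<psi> :: "real ^ 'n \<Rightarrow> real" where \<psi>: "C1_on UNIV \<psi>" "\<And>x. 0 \<le> \<psi> x" "\<And>x. x \<in> K' \<Longrightarrow> \<psi> x = 1"
      "compact (closure {x. \<psi> x \<noteq> 0})" "closure {x. \<psi> x \<noteq> 0} \<subseteq> \<Omega>"
    by (rule C1_Urysohn[OF K'(1) \<Omega> K'(2)]) blast
  define K where "K = closure {x. \<psi> x \<noteq> 0}"
  have K: "compact K" "K \<subseteq> \<Omega>" using \<psi> by (auto simp: K_def)
  have \<psi>0: "\<psi> x = 0" if "x \<notin> K" for x
    using that closure_subset[of "{x. \<psi> x \<noteq> 0}"] by (auto simp: K_def)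
  have \<eta>_K: "\<eta> x = 0" if "x \<notin> K" for x
    using \<psi>0[OF that] \<psi>(3)[of x] \<eta>0[of x] by (cases "x \<in> K'") auto
  have N1: "N n \<ge> 1" for n using n0(1) by (simp add: N_def)
  have vpos: "norm v > 0" using v by simp
  obtain m :: nat and h' :: "real \<Rightarrow> real" where m: "m > 0" "continuous_on UNIV h'"
    "\<And>t. ((\<lambda>t. if t > 0 then \<phi> (norm v * t ^ m) * t ^ m else 0) has_real_derivative h' t) (at t)"
    by (rule admissible_power_profile[OF adm vpos]) blast
  \<comment> \<open>Off the support of \<eta>, \<open>u n x\<close> is \<open>a x\<close> times
    \<open>v\<close> and its image under v -> \<phi>(|v|) v is \<open>b x\<close> times
    \<open>v\<close>; the power \<open>m\<close> makes both factors continuously differentiable,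
    even where \<psi> vanishes.\<close>
  define a where "a x = \<psi> x ^ m" for x
  define b where "b x = (if \<psi> x > 0 then \<phi> (norm v * \<psi> x ^ m) * \<psi> x ^ m else 0)" for x
  define w where "w n x = \<eta> x * (1 / N n * \<sigma> ((N n)\<^sup>2 * x $ h))" for n x
  define u where "u n x = a x *\<^sub>R v + w n x *\<^sub>R p" for n x
  define V where "V n x = \<phi> (norm (u n x)) *\<^sub>R u n x" for n x
  define \<tau> where "\<tau> k n x = (if k = h then \<eta> x * \<sigma>' ((N n)\<^sup>2 * x $ h) else 0)" for k n x
  have a: "C1_on UNIV a" unfolding a_def
    by (rule C1_on_compose_real[OF \<psi>(1), of "\<lambda>t. t ^ m" "\<lambda>t. real m * t ^ (m - 1)"])
      (auto intro!: derivative_eq_intros continuous_intros)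
  have b: "C1_on UNIV b" unfolding b_def
    by (rule C1_on_compose_real[OF \<psi>(1) m(3,2)])
  have \<sigma>C: "C1_on UNIV (\<lambda>x. \<sigma> ((N n)\<^sup>2 * x $ h))" for n
    by (intro C1_on_compose_real[OF _ \<sigma>(1,2)] C1_on_mult C1_on_const C1_on_nth)
  have w: "C1_on UNIV (w n)" for n
    unfolding w_def by (intro C1_on_mult C1_on_const \<eta>(1) \<sigma>C)
  have u: "C1_on UNIV (u n)" for n
    unfolding u_def by (intro C1_on_add C1_on_scaleR C1_on_const a w)
  have ab0: "a x = 0" "b x = 0" "u n x = 0" if "x \<notin> K" for n x
    using \<psi>0[OF that] \<eta>_K[OF that] m(1) by (auto simp: a_def b_def u_def w_def)
  note dif = C1_on_differentiable[OF _ UNIV_I]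
  \<comment> \<open>The phase contributes a factor N^2 against the amplitude 1/N, which gives the
    main term of size N; the derivative of \<eta> only contributes order 1/N.\<close>
  have pd_w: "pderiv_dir k (w n) x = \<tau> k n x * N n + pderiv_dir k \<eta> x * \<sigma> ((N n)\<^sup>2 * x $ h) / N n" for k n x
  proof -
    have 1: "pderiv_dir k (\<lambda>x. (N n)\<^sup>2 * x $ h) x = (N n)\<^sup>2 * (if k = h then 1 else 0)"
      using pderiv_dir_mult[of "\<lambda>_. (N n)\<^sup>2" x "\<lambda>x. x $ h" k, OF dif[OF C1_on_const] dif[OF C1_on_nth]]
      by (auto simp: pderiv_dir_nth)
    have 2: "pderiv_dir k (\<lambda>x. \<sigma> ((N n)\<^sup>2 * x $ h)) x = \<sigma>' ((N n)\<^sup>2 * x $ h) * ((N n)\<^sup>2 * (if k = h then 1 else 0))"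
      using pderiv_dir_compose_real[of "\<lambda>x. (N n)\<^sup>2 * x $ h" x \<sigma> "\<sigma>' ((N n)\<^sup>2 * x $ h)" k,
        OF dif[OF C1_on_mult[OF C1_on_const C1_on_nth]] \<sigma>(1)]
      unfolding 1 by simp
    have 3: "pderiv_dir k (\<lambda>x. 1 / N n * \<sigma> ((N n)\<^sup>2 * x $ h)) x =
        1 / N n * (\<sigma>' ((N n)\<^sup>2 * x $ h) * ((N n)\<^sup>2 * (if k = h then 1 else 0)))"
      using pderiv_dir_mult[of "\<lambda>_. 1 / N n" x "\<lambda>x. \<sigma> ((N n)\<^sup>2 * x $ h)" k, OF dif[OF C1_on_const] dif[OF \<sigma>C]]
      unfolding 2 by simp
    have "pderiv_dir k (w n) x = \<eta> x * (1 / N n * (\<sigma>' ((N n)\<^sup>2 * x $ h) * ((N n)\<^sup>2 * (if k = h then 1 else 0))))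
        + pderiv_dir k \<eta> x * (1 / N n * \<sigma> ((N n)\<^sup>2 * x $ h))"
      using pderiv_dir_mult[of \<eta> x "\<lambda>x. 1 / N n * \<sigma> ((N n)\<^sup>2 * x $ h)" k,
        OF dif[OF \<eta>(1)] dif[OF C1_on_mult[OF C1_on_const \<sigma>C]]]
      unfolding 3 by (simp add: w_def[abs_def])
    then show ?thesis using N1[of n] by (simp add: \<tau>_def power2_eq_square field_simps)
  qed
  have pd_u: "pderiv_dir k (u n) x = pderiv_dir k a x *\<^sub>R v + pderiv_dir k (w n) x *\<^sub>R p" for k n x
    unfolding u_def[abs_def]
    by (simp add: pderiv_dir_add pderiv_dir_scaleR_const dif[OF a] dif[OF w]
        dif[OF C1_on_scaleR[OF a C1_on_const]] dif[OF C1_on_scaleR[OF w C1_on_const]])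
  \<comment> \<open>Here \<open>n0\<close> matters: already for \<open>n = 0\<close> the
    perturbation is at most half the length of \<open>v\<close>. Hence on \<open>K'\<close> the
    values of \<open>u n\<close> stay in an annulus away from 0, where \<open>dPhi\<close> is
    bounded.\<close>
  have wp: "norm (w n x *\<^sub>R p) \<le> norm v / 2" for n x
  proof -
    have "norm (w n x *\<^sub>R p) = (\<bar>\<eta> x\<bar> * norm p) * \<bar>\<sigma> ((N n)\<^sup>2 * x $ h)\<bar> / N n"
      using N1[of n] by (simp add: w_def abs_mult)
    also have "\<dots> \<le> (\<bar>\<eta> x\<bar> * norm p) * 1 / N n"
      using N1[of n] \<sigma>(3) by (intro divide_right_mono mult_left_mono) auto
    also have "\<dots> \<le> (N n * (norm v / 2)) / N n"
    proof (intro divide_right_mono)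
      show "\<bar>\<eta> x\<bar> * norm p * 1 \<le> N n * (norm v / 2)"
      proof -
        have "real n0 * (norm v / 2) \<le> N n * (norm v / 2)" by (intro mult_right_mono) (auto simp: N_def)
        then show ?thesis using n0(2)[of x] by simp
      qed
    qed (use N1[of n] in simp)
    also have "\<dots> = norm v / 2" using N1[of n] by simp
    finally show ?thesis .
  qed
  have u_K': "u n x = v + w n x *\<^sub>R p" if "x \<in> K'" for n x
    using \<psi>(3)[OF that] by (simp add: u_def a_def)
  have u_bd: "norm v / 2 \<le> norm (u n x)" "norm (u n x) \<le> 2 * norm v" if "x \<in> K'" for n x
  proof -
    show "norm v / 2 \<le> norm (u n x)"
      using wp[of n x] norm_triangle_ineq2[of v "- (w n x *\<^sub>R p)"] by (simp add: u_K'[OF that])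
    show "norm (u n x) \<le> 2 * norm v"
      using wp[of n x] norm_triangle_ineq[of v "w n x *\<^sub>R p"] norm_ge_zero[of v] unfolding u_K'[OF that] by linarith
  qed
  have V_out: "V n x = b x *\<^sub>R v" if "x \<in> - K'" for n x
    using \<psi>(2)[of x] \<eta>0[of x] that m(1)
    by (cases "\<psi> x = 0") (auto simp: V_def u_def w_def a_def b_def mult.commute)
  have C1_V_out: "C1_on (- K') (V n)" for n
    by (rule C1_on_cong_open[of _ "\<lambda>x. b x *\<^sub>R v"])
      (use K'(3) V_out C1_on_subset[OF C1_on_scaleR[OF b C1_on_const], of "- K'" v] in auto)
  have opn: "open {x. u n x \<noteq> 0}" for n
    using C1_on_continuous[OF u] by (intro open_Collect_neq continuous_intros)
  have C1_V_in: "C1_on {x. u n x \<noteq> 0} (V n)" for n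
    unfolding V_def
    by (rule C1_on_compose[OF C1_on_subset[OF u] has_derivative_dPhi[OF adm], where T = "- {0}"])
      (auto intro!: continuous_on_dPhi adm)
  \<comment> \<open>\<open>V n\<close> is continuously differentiable on both open sets: on the
    first as a multiple of \<open>v\<close>, on the second by the chain rule. They cover the space
    because \<open>u n\<close> has no zero in \<open>K'\<close>.\<close>
  have UN: "- K' \<union> {x. u n x \<noteq> 0} = UNIV" for n
  proof -
    have "u n x \<noteq> 0" if "x \<in> K'" for x using u_bd(1)[OF that, of n] v by auto
    then show ?thesis by auto
  qed
  have VC1: "C1_on UNIV (V n)" for n
    using C1_on_Un[OF C1_V_out C1_V_in[of n] _ opn] K'(3) unfolding UN by auto
  have pd_V_out: "pderiv_dir k (V n) x = pderiv_dir k b x *\<^sub>R v" if "x \<notin> K'" for k n x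
  proof -
    have "pderiv_dir k (V n) x = pderiv_dir k (\<lambda>x. b x *\<^sub>R v) x"
      by (rule pderiv_dir_cong_open(2)[of "- K'"])
        (use that K'(3) V_out in \<open>auto intro: dif[OF C1_on_scaleR[OF b C1_on_const]]\<close>)
    then show ?thesis by (simp add: pderiv_dir_scaleR_const dif[OF b])
  qed
  have pd_V_in: "pderiv_dir k (V n) x = dPhi \<phi> (u n x) (pderiv_dir k (u n) x)" if "x \<in> K'" for k n x
  proof -
    have "u n x \<noteq> 0" using u_bd(1)[OF that, of n] v by auto
    then show ?thesis unfolding V_def
      by (intro pderiv_dir_compose dif[OF u] has_derivative_dPhi adm)
  qed
  obtain Ca where Ca: "Ca \<ge> 0" "\<And>k x. \<bar>pderiv_dir k a x\<bar> \<le> Ca"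
    by (rule C1_on_compact_support_bounded[OF a K(1)]) (use ab0(1) in auto)
  obtain Cb where Cb: "Cb \<ge> 0" "\<And>k x. \<bar>pderiv_dir k b x\<bar> \<le> Cb"
    by (rule C1_on_compact_support_bounded[OF b K(1)]) (use ab0(2) in auto)
  obtain Ce where Ce: "Ce \<ge> 0" "\<And>x. \<bar>\<eta> x\<bar> \<le> Ce" "\<And>k x. \<bar>pderiv_dir k \<eta> x\<bar> \<le> Ce"
    by (rule C1_on_compact_support_bounded[OF \<eta>(1) K(1)]) (use \<eta>_K in auto)
  obtain M where M: "M \<ge> 0"
    "\<And>y q::complex^'m. norm v / 2 \<le> norm y \<Longrightarrow> norm y \<le> 2 * norm v \<Longrightarrow> norm (dPhi \<phi> y q) \<le> M * norm q"
    by (rule dPhi_bounded[OF adm, of "norm v / 2" "2 * norm v"]) (use v in auto)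
  define C1 where "C1 = Ca * norm v + Ce * norm p"
  have C1: "C1 \<ge> 0" using Ca Ce by (simp add: C1_def)
  have \<tau>_bd: "\<bar>\<tau> k n x\<bar> \<le> Ce" for k n x
    using mult_mono[OF Ce(2) \<sigma>(4)] Ce(1) by (auto simp: \<tau>_def abs_mult)
  \<comment> \<open>After division by N the cutoff contributes order 1/N and the derivative of
    \<eta> order 1/N^2.\<close>
  have err: "norm ((1 / N n) *\<^sub>R pderiv_dir k (u n) x - \<tau> k n x *\<^sub>R p) \<le> C1 / N n" for k n x
  proof -
    have "(1 / N n) *\<^sub>R pderiv_dir k (u n) x - \<tau> k n x *\<^sub>R p =
        (pderiv_dir k a x / N n) *\<^sub>R v + (pderiv_dir k \<eta> x * \<sigma> ((N n)\<^sup>2 * x $ h) / N n / N n) *\<^sub>R p"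
      using N1[of n] unfolding pd_u pd_w by (simp add: scaleR_add_right scaleR_add_left add_divide_distrib)
    also have "norm \<dots> \<le> \<bar>pderiv_dir k a x\<bar> / N n * norm v + \<bar>pderiv_dir k \<eta> x * \<sigma> ((N n)\<^sup>2 * x $ h)\<bar> / N n / N n * norm p"
      using N1[of n] by (intro order_trans[OF norm_triangle_ineq]) simp
    also have "\<dots> \<le> Ca / N n * norm v + Ce * 1 / N n / 1 * norm p"
      using N1[of n] Ca Ce \<sigma>(3) unfolding abs_mult
      by (intro add_mono mult_right_mono divide_right_mono frac_le mult_mono divide_nonneg_pos mult_nonneg_nonneg) auto
    also have "\<dots> = C1 / N n" by (simp add: C1_def add_divide_distrib)
    finally show ?thesis .
  qed
  define Cu where "Cu = C1 + Ce * norm p"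
  have Cu: "Cu \<ge> 0" using C1 Ce by (simp add: Cu_def)
  have pd_u_bd: "norm (pderiv_dir k (u n) x) \<le> Cu * N n" for k n x
  proof -
    have "norm ((1 / N n) *\<^sub>R pderiv_dir k (u n) x) \<le> C1 / N n + norm (\<tau> k n x *\<^sub>R p)"
      using err[of n k x] norm_triangle_ineq2[of "(1 / N n) *\<^sub>R pderiv_dir k (u n) x" "\<tau> k n x *\<^sub>R p"] by linarith
    also have "\<dots> \<le> C1 / 1 + Ce * norm p"
      using N1[of n] C1 \<tau>_bd by (intro add_mono frac_le) (auto intro: mult_right_mono)
    finally show ?thesis using N1[of n] by (simp add: Cu_def field_simps)
  qed
  have inv0: "(\<lambda>n. c / N n) \<longlonglongrightarrow> 0" for c
    unfolding N_def using LIMSEQ_ignore_initial_segment[OF lim_const_over_n[of c], of n0] by simp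
  define C where "C = Cu + Cb * norm v + M * Cu"
  show ?thesis
  proof (rule that[of K C u])
    show "compact K" "K \<subseteq> \<Omega>" by fact+
    show "C \<ge> 0" using Cu Cb M by (simp add: C_def)
    show "u n \<in> C10 \<Omega>" for n
      by (rule C10_I[OF u K]) (use ab0(3) in auto)
    show "(\<lambda>x. \<phi> (norm (u n x)) *\<^sub>R u n x) \<in> C10 \<Omega>" for n
      by (rule C10_I[OF VC1[unfolded V_def] K]) (use ab0(3) in auto)
    show "pderiv_dir k (u n) x = 0" if "x \<notin> K" for n k x
    proof (rule pderiv_dir_eq_0_outside_support)
      have "closure {x. u n x \<noteq> 0} \<subseteq> K"
        using ab0(3) K(1) by (intro closure_minimal) (auto simp: compact_imp_closed)
      then show "x \<notin> closure {x. u n x \<noteq> 0}" using that by auto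
    qed
    show "norm (pderiv_dir k (u n) x) \<le> C * N n" for n k x
    proof -
      have "Cu * N n \<le> C * N n" using N1[of n] Cb M Cu by (intro mult_right_mono) (auto simp: C_def)
      then show ?thesis using pd_u_bd[of k n x] by linarith
    qed
    have "norm (pderiv_dir k (V n) x) \<le> C * N n" for n k x
    proof (cases "x \<in> K'")
      case True
      have "norm (pderiv_dir k (V n) x) \<le> M * (Cu * N n)"
        unfolding pd_V_in[OF True]
        using M(2)[OF u_bd[OF True]] pd_u_bd[of k n x] M(1) by (meson mult_left_mono order_trans)
      also have "\<dots> \<le> C * N n" using N1[of n] Cb Cu M by (simp add: C_def algebra_simps)
      finally show ?thesis .
    next
      case False
      have "norm (pderiv_dir k (V n) x) \<le> Cb * norm v * 1"
        unfolding pd_V_out[OF False] using Cb(2) by (simp add: mult_right_mono)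
      also have "\<dots> \<le> C * N n"
        using N1[of n] Cb Cu M by (intro mult_mono) (auto simp: C_def)
      finally show ?thesis .
    qed
    then show "norm (pderiv_dir k (\<lambda>x. \<phi> (norm (u n x)) *\<^sub>R u n x) x) \<le> C * N n" for n k x
      unfolding V_def .
    show "(\<lambda>n. (1 / N n) *\<^sub>R pderiv_dir k (u n) x
        - (if k = h then \<eta> x * \<sigma>' ((N n)\<^sup>2 * x $ h) else 0) *\<^sub>R p) \<longlonglongrightarrow> 0" for k x
      unfolding \<tau>_def[symmetric] by (rule Lim_null_comparison[OF _ inv0[of C1]]) (use err in auto)
    have "(\<lambda>n. (1 / N n) *\<^sub>R pderiv_dir k (V n) x - \<tau> k n x *\<^sub>R dPhi \<phi> v p) \<longlonglongrightarrow> 0" for k x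
    proof (cases "x \<in> K'")
      case False
      show ?thesis
      proof (rule Lim_null_comparison[OF _ inv0[of "Cb * norm v"]])
        show "\<forall>\<^sub>F n in sequentially. norm ((1 / N n) *\<^sub>R pderiv_dir k (V n) x - \<tau> k n x *\<^sub>R dPhi \<phi> v p) \<le> Cb * norm v / N n"
        proof (intro always_eventually allI)
          fix n
          have "\<tau> k n x = 0" using \<eta>0[OF False] by (simp add: \<tau>_def)
          then have "norm ((1 / N n) *\<^sub>R pderiv_dir k (V n) x - \<tau> k n x *\<^sub>R dPhi \<phi> v p) = \<bar>pderiv_dir k b x\<bar> * norm v / N n"
            using N1[of n] by (simp add: pd_V_out[OF False])
          also have "\<dots> \<le> Cb * norm v / N n"
            using N1[of n] Cb(2) by (intro divide_right_mono mult_right_mono) auto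
          finally show "norm ((1 / N n) *\<^sub>R pderiv_dir k (V n) x - \<tau> k n x *\<^sub>R dPhi \<phi> v p) \<le> Cb * norm v / N n" .
        qed
      qed
    next
      case True
      have "(\<lambda>n. w n x) \<longlonglongrightarrow> 0"
      proof (rule Lim_null_comparison[OF _ inv0[of Ce]])
        have "\<bar>\<eta> x\<bar> * \<bar>\<sigma> ((N n)\<^sup>2 * x $ h)\<bar> \<le> Ce * 1" for n
          using Ce \<sigma>(3) by (intro mult_mono) auto
        then have "norm (w n x) \<le> Ce / N n" for n
          using N1[of n] by (simp add: w_def abs_mult divide_right_mono)
        then show "\<forall>\<^sub>F n in sequentially. norm (w n x) \<le> Ce / N n" by simp
      qed
      then have "(\<lambda>n. u n x) \<longlonglongrightarrow> v + 0 *\<^sub>R p" unfolding u_K'[OF True] by (intro tendsto_intros)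
      then have ulim: "(\<lambda>n. (u n x, p)) \<longlonglongrightarrow> (v, p)" by (intro tendsto_intros) simp
      have un: "u n x \<noteq> 0" for n using u_bd(1)[OF True, of n] v by auto
      have "(\<lambda>n. (\<lambda>(v, q). dPhi \<phi> v q) (u n x, p)) \<longlonglongrightarrow> (\<lambda>(v, q). dPhi \<phi> v q) (v, p)"
        by (rule continuous_on_tendsto_compose[OF continuous_on_dPhi[OF adm] ulim]) (use v un in auto)
      then have "(\<lambda>n. dPhi \<phi> (u n x) p - dPhi \<phi> v p) \<longlonglongrightarrow> 0" by (simp add: LIM_zero)
      from tendsto_add[OF inv0[of "M * C1"] tendsto_mult[OF tendsto_const[of Ce] tendsto_norm_zero[OF this]]]
      have lim2: "(\<lambda>n. M * C1 / N n + Ce * norm (dPhi \<phi> (u n x) p - dPhi \<phi> v p)) \<longlonglongrightarrow> 0"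
        by simp
      show ?thesis
      proof (rule Lim_null_comparison[OF always_eventually lim2], rule allI)
        fix n
        \<comment> \<open>The error splits into the error of the direction, controlled by the
          uniform bound \<open>M\<close>, and the error of the base point, which vanishes in the
          limit by continuity of \<open>dPhi\<close>.\<close>
        have "(1 / N n) *\<^sub>R pderiv_dir k (V n) x - \<tau> k n x *\<^sub>R dPhi \<phi> v p =
          dPhi \<phi> (u n x) ((1 / N n) *\<^sub>R pderiv_dir k (u n) x - \<tau> k n x *\<^sub>R p) + \<tau> k n x *\<^sub>R (dPhi \<phi> (u n x) p - dPhi \<phi> v p)"
          unfolding pd_V_in[OF True] dPhi_diff dPhi_scaleR by (simp add: scaleR_diff_right)
        also have "norm \<dots> \<le> M * (C1 / N n) + Ce * norm (dPhi \<phi> (u n x) p - dPhi \<phi> v p)"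
        proof (intro order_trans[OF norm_triangle_ineq] add_mono)
          show "norm (dPhi \<phi> (u n x) ((1 / N n) *\<^sub>R pderiv_dir k (u n) x - \<tau> k n x *\<^sub>R p)) \<le> M * (C1 / N n)"
            using M(2)[OF u_bd[OF True]] err[of n k x] M(1) by (meson mult_left_mono order_trans)
          show "norm (\<tau> k n x *\<^sub>R (dPhi \<phi> (u n x) p - dPhi \<phi> v p)) \<le> Ce * norm (dPhi \<phi> (u n x) p - dPhi \<phi> v p)"
            using \<tau>_bd by (simp add: mult_right_mono)
        qed
        finally show "norm ((1 / N n) *\<^sub>R pderiv_dir k (V n) x - \<tau> k n x *\<^sub>R dPhi \<phi> v p)
          \<le> M * C1 / N n + Ce * norm (dPhi \<phi> (u n x) p - dPhi \<phi> v p)" by simp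
      qed
    qed
    then show "(\<lambda>n. (1 / N n) *\<^sub>R pderiv_dir k (\<lambda>x. \<phi> (norm (u n x)) *\<^sub>R u n x) x
        - (if k = h then \<eta> x * \<sigma>' ((N n)\<^sup>2 * x $ h) else 0) *\<^sub>R dPhi \<phi> v p) \<longlonglongrightarrow> 0" for k x
      unfolding V_def \<tau>_def .
  qed
qed

section \<open>Bounds and limits of the integrand\<close>

lemma cdot_mult_bound:
  fixes B :: "complex ^ 'm ^ 'm"
  shows "norm (cdot (B *v q) r) \<le> (\<Sum>i\<in>UNIV. \<Sum>j\<in>UNIV. norm (B $ i $ j)) * (norm q * norm r)"
proof -
  have "norm (cdot (B *v q) r) \<le> (\<Sum>i\<in>UNIV. norm ((B *v q) $ i * cnj (r $ i)))"
    unfolding cdot_def by (rule norm_sum)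
  also have "\<dots> \<le> (\<Sum>i\<in>UNIV. (\<Sum>j\<in>UNIV. norm (B $ i $ j)) * (norm q * norm r))"
  proof (rule sum_mono)
    fix i
    have "norm ((B *v q) $ i) \<le> (\<Sum>j\<in>UNIV. norm (B $ i $ j) * norm (q $ j))"
      unfolding matrix_vector_mult_def by (simp add: order_trans[OF norm_sum] norm_mult)
    also have "\<dots> \<le> (\<Sum>j\<in>UNIV. norm (B $ i $ j) * norm q)"
      by (intro sum_mono mult_left_mono Finite_Cartesian_Product.norm_nth_le) auto
    finally have "norm ((B *v q) $ i) \<le> (\<Sum>j\<in>UNIV. norm (B $ i $ j)) * norm q"
      by (simp add: sum_distrib_right)
    then have "norm ((B *v q) $ i) * norm (r $ i) \<le> ((\<Sum>j\<in>UNIV. norm (B $ i $ j)) * norm q) * norm r"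
      by (intro mult_mono Finite_Cartesian_Product.norm_nth_le) (simp_all add: sum_nonneg)
    then show "norm ((B *v q) $ i * cnj (r $ i)) \<le> (\<Sum>j\<in>UNIV. norm (B $ i $ j)) * (norm q * norm r)"
      by (simp add: norm_mult mult.assoc)
  qed
  finally show ?thesis by (simp add: sum_distrib_right)
qed

lemma cdot_diff_left: "cdot (v - w) r = cdot v r - cdot w r"
  by (simp add: cdot_def sum_subtractf left_diff_distrib)

lemma cdot_diff_right: "cdot r (v - w) = cdot r v - cdot r w"
  by (simp add: cdot_def sum_subtractf right_diff_distrib)

lemma cdot_scaleR_left: "cdot (c *\<^sub>R v) r = c *\<^sub>R cdot v r"
  by (simp add: cdot_def scaleR_sum_right)

lemma cdot_scaleR_right: "cdot r (c *\<^sub>R v) = c *\<^sub>R cdot r v"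
  by (simp add: cdot_def scaleR_sum_right)

text \<open>The factors \<open>c n\<close> are only bounded and need not converge, so the limit is
  expressed through differences. Replacing first the left and then the right argument leaves two
  error terms, each with a factor tending to 0.\<close>

lemma cdot_mult_tendsto:
  fixes B :: "complex ^ 'm ^ 'm"
  assumes q: "(\<lambda>n. q n - c n *\<^sub>R p) \<longlonglongrightarrow> 0" and r: "(\<lambda>n. r n - c n *\<^sub>R P) \<longlonglongrightarrow> 0"
    and c: "\<And>n. \<bar>c n\<bar> \<le> M"
  shows "(\<lambda>n. cdot (B *v q n) (r n) - (c n)\<^sup>2 *\<^sub>R cdot (B *v p) P) \<longlonglongrightarrow> 0"
proof -
  define b where "b = (\<Sum>i\<in>UNIV. \<Sum>j\<in>UNIV. norm (B $ i $ j))"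
  have b0: "b \<ge> 0" by (simp add: b_def sum_nonneg)
  have M0: "M \<ge> 0" using c[of 0] by simp
  define dq where "dq n = norm (q n - c n *\<^sub>R p)" for n
  define dr where "dr n = norm (r n - c n *\<^sub>R P)" for n
  have "(\<lambda>n. b * (dq n * (dr n + M * norm P)) + M * (b * (norm p * dr n))) \<longlonglongrightarrow>
      b * (0 * (0 + M * norm P)) + M * (b * (norm p * 0))"
    unfolding dq_def dr_def by (intro tendsto_intros tendsto_norm_zero q r)
  then have lim: "(\<lambda>n. b * (dq n * (dr n + M * norm P)) + M * (b * (norm p * dr n))) \<longlonglongrightarrow> 0" by simp
  show ?thesis
  proof (rule Lim_null_comparison[OF always_eventually lim], rule allI)
    fix n
    have "cdot (B *v q n) (r n) - (c n)\<^sup>2 *\<^sub>R cdot (B *v p) P =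
        cdot (B *v (q n - c n *\<^sub>R p)) (r n) + c n *\<^sub>R cdot (B *v p) (r n - c n *\<^sub>R P)"
      by (simp add: matrix_vector_mult_diff_distrib matrix_vector_mult_scaleR_right cdot_diff_left cdot_diff_right
          cdot_scaleR_left cdot_scaleR_right scaleR_diff_right power2_eq_square)
    also have "norm \<dots> \<le> b * (dq n * (dr n + M * norm P)) + M * (b * (norm p * dr n))"
    proof (intro order_trans[OF norm_triangle_ineq] add_mono)
      have "norm (r n) \<le> dr n + norm (c n *\<^sub>R P)"
        unfolding dr_def using norm_triangle_sub by (metis add.commute)
      also have "norm (c n *\<^sub>R P) \<le> M * norm P" using c by (simp add: mult_right_mono)
      finally have "norm (r n) \<le> dr n + M * norm P" by simp
      then have "b * (dq n * norm (r n)) \<le> b * (dq n * (dr n + M * norm P))"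
        using b0 by (intro mult_left_mono) (auto simp: dq_def)
      then show "norm (cdot (B *v (q n - c n *\<^sub>R p)) (r n)) \<le> b * (dq n * (dr n + M * norm P))"
        using cdot_mult_bound[of B "q n - c n *\<^sub>R p" "r n"] unfolding b_def[symmetric] dq_def by linarith
      have "\<bar>c n\<bar> * norm (cdot (B *v p) (r n - c n *\<^sub>R P)) \<le> M * (b * (norm p * dr n))"
        unfolding b_def dr_def using c M0 by (intro mult_mono cdot_mult_bound) auto
      then show "norm (c n *\<^sub>R cdot (B *v p) (r n - c n *\<^sub>R P)) \<le> M * (b * (norm p * dr n))"
        by simp
    qed
    finally show "norm (cdot (B *v q n) (r n) - (c n)\<^sup>2 *\<^sub>R cdot (B *v p) P)
       \<le> b * (dq n * (dr n + M * norm P)) + M * (b * (norm p * dr n))" .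
  qed
qed

text \<open>The sum of the absolute values of all entries, cut off to \<open>K\<close>. It bounds
  the matrices through \<open>cdot_mult_bound\<close> and is integrable by local integrability of
  the entries, so its multiples serve as majorants.\<close>

definition coeff_abs :: "('n::finite \<Rightarrow> real ^ 'n \<Rightarrow> complex ^ 'm ^ 'm) \<Rightarrow> (real ^ 'n) set \<Rightarrow> real ^ 'n \<Rightarrow> real" where
  "coeff_abs A K x = (\<Sum>k\<in>UNIV. \<Sum>i\<in>UNIV. \<Sum>j\<in>UNIV. indicator K x *\<^sub>R norm (A k x $ i $ j))"

definition dissipation_integrand ::
  "(real \<Rightarrow> real) \<Rightarrow> ('n::finite \<Rightarrow> real ^ 'n \<Rightarrow> complex ^ 'm ^ 'm) \<Rightarrow> (real ^ 'n \<Rightarrow> complex ^ 'm) \<Rightarrow> real ^ 'n \<Rightarrow> complex" where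
  "dissipation_integrand \<phi> A u x = (\<Sum>k\<in>UNIV. cdot (A k x *v pderiv_dir k u x)
                   (pderiv_dir k (\<lambda>y. \<phi> (norm (u y)) *\<^sub>R u y) x))"

lemma coeff_abs_integrable:
  fixes A :: "'n::finite \<Rightarrow> real ^ 'n \<Rightarrow> complex ^ 'm ^ 'm"
  assumes A: "\<And>h i j. L1_loc \<Omega> (\<lambda>x. A h x $ i $ j)" and K: "compact K" "K \<subseteq> \<Omega>"
  shows "integrable lebesgue (coeff_abs A K)"
  unfolding coeff_abs_def[abs_def]
proof (intro Bochner_Integration.integrable_sum)
  fix k i j
  have "integrable lebesgue (\<lambda>x. indicator K x *\<^sub>R (A k x $ i $ j))"
    using A[of k i j] K by (simp add: L1_loc_def set_integrable_def)
  from integrable_norm[OF this] show "integrable lebesgue (\<lambda>x. indicator K x *\<^sub>R norm (A k x $ i $ j))"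
    by simp
qed

text \<open>Each summand is an entry cut off to \<open>K\<close>, measurable by local integrability,
  times a continuous function on \<Omega> extended by 0. The cutoff to \<open>K\<close> changes
  nothing because the derivatives of \<open>u\<close> vanish off \<open>K\<close>.\<close>

lemma dissipation_integrand_measurable:
  fixes A :: "'n::finite \<Rightarrow> real ^ 'n \<Rightarrow> complex ^ 'm ^ 'm"
  assumes A: "\<And>h i j. L1_loc \<Omega> (\<lambda>x. A h x $ i $ j)" and \<Omega>: "open \<Omega>" and K: "compact K" "K \<subseteq> \<Omega>"
    and u: "u \<in> C10 \<Omega>" "(\<lambda>x. \<phi> (norm (u x)) *\<^sub>R u x) \<in> C10 \<Omega>"
    and supp: "\<And>k x. x \<notin> K \<Longrightarrow> pderiv_dir k u x = 0"
  shows "(\<lambda>x. indicator \<Omega> x *\<^sub>R dissipation_integrand \<phi> A u x) \<in> borel_measurable lebesgue"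
proof -
  let ?V = "\<lambda>x. \<phi> (norm (u x)) *\<^sub>R u x"
  have "(\<lambda>x. indicator \<Omega> x *\<^sub>R dissipation_integrand \<phi> A u x) = (\<lambda>x. \<Sum>k\<in>UNIV. \<Sum>i\<in>UNIV. \<Sum>j\<in>UNIV.
      (indicator K x *\<^sub>R (A k x $ i $ j)) * (indicator \<Omega> x *\<^sub>R (pderiv_dir k u x $ j * cnj (pderiv_dir k ?V x $ i))))"
  proof
    fix x
    show "indicator \<Omega> x *\<^sub>R dissipation_integrand \<phi> A u x = (\<Sum>k\<in>UNIV. \<Sum>i\<in>UNIV. \<Sum>j\<in>UNIV.
      (indicator K x *\<^sub>R (A k x $ i $ j)) * (indicator \<Omega> x *\<^sub>R (pderiv_dir k u x $ j * cnj (pderiv_dir k ?V x $ i))))"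
      using supp[of x] K(2)
      by (cases "x \<in> K") (auto simp: dissipation_integrand_def cdot_def matrix_vector_mult_def sum_distrib_right mult.assoc)
  qed
  moreover have "\<dots> \<in> borel_measurable lebesgue"
  proof (intro borel_measurable_sum borel_measurable_times)
    fix k i j
    show "(\<lambda>x. indicator K x *\<^sub>R (A k x $ i $ j)) \<in> borel_measurable lebesgue"
      using A[of k i j] K by (auto simp: L1_loc_def set_integrable_def)
    have "continuous_on \<Omega> (\<lambda>x. pderiv_dir k u x $ j * cnj (pderiv_dir k ?V x $ i))"
      using u by (intro continuous_intros) (auto simp: C10_def)
    then have "(\<lambda>x. indicator \<Omega> x *\<^sub>R (pderiv_dir k u x $ j * cnj (pderiv_dir k ?V x $ i))) \<in> borel_measurable borel"
      using \<Omega> by (intro borel_measurable_continuous_on_indicator) auto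
    then show "(\<lambda>x. indicator \<Omega> x *\<^sub>R (pderiv_dir k u x $ j * cnj (pderiv_dir k ?V x $ i))) \<in> borel_measurable lebesgue"
      by (simp add: measurable_completion)
  qed
  ultimately show ?thesis by simp
qed

lemma dissipation_integrand_bound:
  fixes A :: "'n::finite \<Rightarrow> real ^ 'n \<Rightarrow> complex ^ 'm ^ 'm"
  assumes supp: "\<And>k x. x \<notin> K \<Longrightarrow> pderiv_dir k u x = 0"
    and b: "\<And>k x. norm (pderiv_dir k u x) \<le> b" "\<And>k x. norm (pderiv_dir k (\<lambda>y. \<phi> (norm (u y)) *\<^sub>R u y) x) \<le> b"
  shows "norm (indicator \<Omega> x *\<^sub>R dissipation_integrand \<phi> A u x) \<le> b\<^sup>2 * coeff_abs A K x"
proof (cases "x \<in> K")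
  case False
  then show ?thesis using supp by (simp add: dissipation_integrand_def coeff_abs_def cdot_def)
next
  case True
  have b0: "b \<ge> 0" using b(1) norm_ge_zero order_trans by blast
  have "norm (indicator \<Omega> x *\<^sub>R dissipation_integrand \<phi> A u x) \<le> norm (dissipation_integrand \<phi> A u x)"
    by (simp add: indicator_def)
  also have "\<dots> \<le> (\<Sum>k\<in>UNIV. norm (cdot (A k x *v pderiv_dir k u x) (pderiv_dir k (\<lambda>y. \<phi> (norm (u y)) *\<^sub>R u y) x)))"
    unfolding dissipation_integrand_def by (rule norm_sum)
  also have "\<dots> \<le> (\<Sum>k\<in>UNIV. (\<Sum>i\<in>UNIV. \<Sum>j\<in>UNIV. norm (A k x $ i $ j)) * (b * b))"
    using b b0
    by (intro sum_mono order_trans[OF cdot_mult_bound] mult_left_mono mult_mono) (simp_all add: sum_nonneg)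
  also have "\<dots> = b\<^sup>2 * coeff_abs A K x"
    using True by (simp add: coeff_abs_def sum_distrib_left sum_distrib_right power2_eq_square mult_ac)
  finally show ?thesis .
qed

text \<open>For one family alone the normalised integrand keeps oscillating. The sum of the
  integrands of the sine and the cosine family converges pointwise, so dominated convergence gives
  the limit of the integrals.\<close>

lemma dissipative_test_integral:
  fixes A :: "'n::finite \<Rightarrow> real ^ 'n \<Rightarrow> complex ^ 'm ^ 'm"
  assumes adm: "admissible \<phi>" and \<Omega>: "open \<Omega>" and A: "\<And>h i j. L1_loc \<Omega> (\<lambda>x. A h x $ i $ j)"
    and diss: "L_Phi_dissipative \<phi> \<Omega> A" and v: "v \<noteq> 0"
    and \<eta>: "C1_on UNIV \<eta>" "compact (closure {x. \<eta> x \<noteq> 0})" "closure {x. \<eta> x \<noteq> 0} \<subseteq> \<Omega>"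
  shows "0 \<le> (LINT x:\<Omega>|lebesgue. (\<eta> x)\<^sup>2 * inner (A h x *v p) (dPhi \<phi> v p))"
proof -
  obtain Ce where Ce: "Ce \<ge> 0" "\<And>x. \<bar>\<eta> x\<bar> \<le> Ce"
    by (rule C1_on_compact_support_bounded[OF \<eta>(1,2) closure_subset]) blast
  \<comment> \<open>Chosen so that |\<eta>| |p| is at most \<open>n0\<close> times half the length
    of \<open>v\<close>; the successor taken next makes \<open>n0\<close> positive.\<close>
  obtain n1 :: nat where n1: "2 * Ce * norm p / norm v \<le> of_nat n1" using real_arch_simple by blast
  define n0 where "n0 = Suc n1"
  have n0: "n0 \<ge> 1" "\<bar>\<eta> x\<bar> * norm p \<le> n0 * (norm v / 2)" for x
  proof -
    have "\<bar>\<eta> x\<bar> * norm p \<le> Ce * norm p" using Ce(2) by (simp add: mult_right_mono)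
    also have "\<dots> = (2 * Ce * norm p / norm v) * (norm v / 2)" using v by simp
    also have "\<dots> \<le> n0 * (norm v / 2)" using n1 by (intro mult_right_mono) (auto simp: n0_def)
    finally show "\<bar>\<eta> x\<bar> * norm p \<le> n0 * (norm v / 2)" .
  qed (simp add: n0_def)
  define N where "N n = real (n + n0)" for n
  have N1: "N n \<ge> 1" for n using n0(1) by (simp add: N_def)
  define P where "P = dPhi \<phi> v p"
  have dcos: "(cos has_real_derivative - sin t) (at t)" "(sin has_real_derivative cos t) (at t)" for t :: real
    by (auto intro!: derivative_eq_intros)
  obtain K1 C1 and u1 :: "nat \<Rightarrow> real ^ 'n \<Rightarrow> complex ^ 'm" where K1: "compact K1" "K1 \<subseteq> \<Omega>" and C1: "C1 \<ge> 0"
    and u1: "\<And>n. u1 n \<in> C10 \<Omega>" "\<And>n. (\<lambda>x. \<phi> (norm (u1 n x)) *\<^sub>R u1 n x) \<in> C10 \<Omega>"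
      "\<And>n k x. x \<notin> K1 \<Longrightarrow> pderiv_dir k (u1 n) x = 0"
      "\<And>n k x. norm (pderiv_dir k (u1 n) x) \<le> C1 * N n"
      "\<And>n k x. norm (pderiv_dir k (\<lambda>x. \<phi> (norm (u1 n x)) *\<^sub>R u1 n x) x) \<le> C1 * N n"
      "\<And>k x. (\<lambda>n. (1 / N n) *\<^sub>R pderiv_dir k (u1 n) x
          - (if k = h then \<eta> x * cos ((N n)\<^sup>2 * x $ h) else 0) *\<^sub>R p) \<longlonglongrightarrow> 0"
      "\<And>k x. (\<lambda>n. (1 / N n) *\<^sub>R pderiv_dir k (\<lambda>x. \<phi> (norm (u1 n x)) *\<^sub>R u1 n x) x
          - (if k = h then \<eta> x * cos ((N n)\<^sup>2 * x $ h) else 0) *\<^sub>R P) \<longlonglongrightarrow> 0"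
    unfolding N_def P_def
    by (rule oscillating_test_functions[OF adm v \<Omega> \<eta> n0 dcos(2), where h = h])
      (auto intro!: continuous_intros)
  obtain K2 C2 and u2 :: "nat \<Rightarrow> real ^ 'n \<Rightarrow> complex ^ 'm" where K2: "compact K2" "K2 \<subseteq> \<Omega>" and C2: "C2 \<ge> 0"
    and u2: "\<And>n. u2 n \<in> C10 \<Omega>" "\<And>n. (\<lambda>x. \<phi> (norm (u2 n x)) *\<^sub>R u2 n x) \<in> C10 \<Omega>"
      "\<And>n k x. x \<notin> K2 \<Longrightarrow> pderiv_dir k (u2 n) x = 0"
      "\<And>n k x. norm (pderiv_dir k (u2 n) x) \<le> C2 * N n"
      "\<And>n k x. norm (pderiv_dir k (\<lambda>x. \<phi> (norm (u2 n x)) *\<^sub>R u2 n x) x) \<le> C2 * N n"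
      "\<And>k x. (\<lambda>n. (1 / N n) *\<^sub>R pderiv_dir k (u2 n) x
          - (if k = h then \<eta> x * - sin ((N n)\<^sup>2 * x $ h) else 0) *\<^sub>R p) \<longlonglongrightarrow> 0"
      "\<And>k x. (\<lambda>n. (1 / N n) *\<^sub>R pderiv_dir k (\<lambda>x. \<phi> (norm (u2 n x)) *\<^sub>R u2 n x) x
          - (if k = h then \<eta> x * - sin ((N n)\<^sup>2 * x $ h) else 0) *\<^sub>R P) \<longlonglongrightarrow> 0"
    unfolding N_def P_def
    by (rule oscillating_test_functions[OF adm v \<Omega> \<eta> n0 dcos(1), where h = h])
      (auto intro!: continuous_intros)
  \<comment> \<open>Both factors of the form grow like N, hence the normalisation by N^2.\<close>
  define s1 where "s1 n x = (1 / (N n)\<^sup>2) *\<^sub>R (indicator \<Omega> x *\<^sub>R dissipation_integrand \<phi> A (u1 n) x)" for n x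
  define s2 where "s2 n x = (1 / (N n)\<^sup>2) *\<^sub>R (indicator \<Omega> x *\<^sub>R dissipation_integrand \<phi> A (u2 n) x)" for n x
  define w1 where "w1 x = C1\<^sup>2 * coeff_abs A K1 x" for x
  define w2 where "w2 x = C2\<^sup>2 * coeff_abs A K2 x" for x
  have w: "integrable lebesgue w1" "integrable lebesgue w2"
    unfolding w1_def w2_def using coeff_abs_integrable[OF A K1] coeff_abs_integrable[OF A K2] by auto
  have meas1: "s1 n \<in> borel_measurable lebesgue" for n
    unfolding s1_def using dissipation_integrand_measurable[OF A \<Omega> K1 u1(1,2,3)] by (rule borel_measurable_const_scaleR)
  have meas2: "s2 n \<in> borel_measurable lebesgue" for n
    unfolding s2_def using dissipation_integrand_measurable[OF A \<Omega> K2 u2(1,2,3)] by (rule borel_measurable_const_scaleR)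
  have bd1: "norm (s1 n x) \<le> w1 x" for n x
  proof -
    have "norm (indicator \<Omega> x *\<^sub>R dissipation_integrand \<phi> A (u1 n) x) \<le> (C1 * N n)\<^sup>2 * coeff_abs A K1 x"
      by (rule dissipation_integrand_bound[OF u1(3,4,5)])
    then have "norm (s1 n x) \<le> 1 / (N n)\<^sup>2 * ((C1 * N n)\<^sup>2 * coeff_abs A K1 x)"
      unfolding s1_def norm_scaleR[of "1 / (N n)\<^sup>2"] real_norm_def
      by (simp add: divide_right_mono)
    then show ?thesis using N1[of n] by (simp add: w1_def power_mult_distrib)
  qed
  have bd2: "norm (s2 n x) \<le> w2 x" for n x
  proof -
    have "norm (indicator \<Omega> x *\<^sub>R dissipation_integrand \<phi> A (u2 n) x) \<le> (C2 * N n)\<^sup>2 * coeff_abs A K2 x"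
      by (rule dissipation_integrand_bound[OF u2(3,4,5)])
    then have "norm (s2 n x) \<le> 1 / (N n)\<^sup>2 * ((C2 * N n)\<^sup>2 * coeff_abs A K2 x)"
      unfolding s2_def norm_scaleR[of "1 / (N n)\<^sup>2"] real_norm_def
      by (simp add: divide_right_mono)
    then show ?thesis using N1[of n] by (simp add: w2_def power_mult_distrib)
  qed
  have int: "integrable lebesgue (s1 n)" "integrable lebesgue (s2 n)" for n
  proof -
    show "integrable lebesgue (s1 n)"
      by (rule Bochner_Integration.integrable_bound[OF w(1) meas1]) (intro AE_I2 order_trans[OF bd1], simp)
    show "integrable lebesgue (s2 n)"
      by (rule Bochner_Integration.integrable_bound[OF w(2) meas2]) (intro AE_I2 order_trans[OF bd2], simp)
  qed
  have diss': "0 \<le> Re (LINT x:\<Omega>|lebesgue. dissipation_integrand \<phi> A u x)"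
    if "u \<in> C10 \<Omega>" "(\<lambda>x. \<phi> (norm (u x)) *\<^sub>R u x) \<in> C10 \<Omega>" for u
    using diss that unfolding L_Phi_dissipative_def dissipation_integrand_def by blast
  have Re1: "Re (integral\<^sup>L lebesgue (s1 n)) \<ge> 0" for n
  proof -
    have "integral\<^sup>L lebesgue (s1 n) = (1 / (N n)\<^sup>2) *\<^sub>R (LINT x:\<Omega>|lebesgue. dissipation_integrand \<phi> A (u1 n) x)"
      unfolding s1_def[abs_def] set_lebesgue_integral_def by (rule integral_scaleR_right)
    then show ?thesis using diss'[OF u1(1,2)[of n]] by simp
  qed
  have Re2: "Re (integral\<^sup>L lebesgue (s2 n)) \<ge> 0" for n
  proof -
    have "integral\<^sup>L lebesgue (s2 n) = (1 / (N n)\<^sup>2) *\<^sub>R (LINT x:\<Omega>|lebesgue. dissipation_integrand \<phi> A (u2 n) x)"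
      unfolding s2_def[abs_def] set_lebesgue_integral_def by (rule integral_scaleR_right)
    then show ?thesis using diss'[OF u2(1,2)[of n]] by simp
  qed
  define D where "D k x = cdot (A k x *v p) P" for k x
  define f where "f x = indicator \<Omega> x *\<^sub>R ((\<eta> x)\<^sup>2 *\<^sub>R D h x)" for x
  have lim: "(\<lambda>n. s1 n x + s2 n x) \<longlonglongrightarrow> f x" for x
  proof (cases "x \<in> \<Omega>")
    case True
    define c where "c k = (if k = h then (\<eta> x)\<^sup>2 else 0)" for k
    define t1 where "t1 k n = cdot (A k x *v ((1 / N n) *\<^sub>R pderiv_dir k (u1 n) x))
        ((1 / N n) *\<^sub>R pderiv_dir k (\<lambda>x. \<phi> (norm (u1 n x)) *\<^sub>R u1 n x) x)" for k n
    define t2 where "t2 k n = cdot (A k x *v ((1 / N n) *\<^sub>R pderiv_dir k (u2 n) x))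
        ((1 / N n) *\<^sub>R pderiv_dir k (\<lambda>x. \<phi> (norm (u2 n x)) *\<^sub>R u2 n x) x)" for k n
    have "(\<lambda>n. t1 k n + t2 k n) \<longlonglongrightarrow> c k *\<^sub>R D k x" for k
    proof -
      define a1 where "a1 n = (if k = h then \<eta> x * cos ((N n)\<^sup>2 * x $ h) else 0)" for n
      define a2 where "a2 n = (if k = h then \<eta> x * - sin ((N n)\<^sup>2 * x $ h) else 0)" for n
      have b1: "\<bar>a1 n\<bar> \<le> Ce" for n
        using mult_mono[OF Ce(2)[of x] abs_cos_le_one] Ce(1) by (auto simp: a1_def abs_mult)
      have b2: "\<bar>a2 n\<bar> \<le> Ce" for n
        using mult_mono[OF Ce(2)[of x] abs_sin_le_one] Ce(1) by (auto simp: a2_def abs_mult)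
      \<comment> \<open>The identity cos^2 + sin^2 = 1 removes the dependence on
        \<open>n\<close>.\<close>
      have c: "(a1 n)\<^sup>2 + (a2 n)\<^sup>2 = c k" for n
        by (simp add: a1_def a2_def c_def power_mult_distrib flip: distrib_left)
      have 1: "(\<lambda>n. t1 k n - (a1 n)\<^sup>2 *\<^sub>R D k x) \<longlonglongrightarrow> 0"
        unfolding t1_def a1_def D_def by (rule cdot_mult_tendsto[OF u1(6,7) b1[unfolded a1_def]])
      have 2: "(\<lambda>n. t2 k n - (a2 n)\<^sup>2 *\<^sub>R D k x) \<longlonglongrightarrow> 0"
        unfolding t2_def a2_def D_def by (rule cdot_mult_tendsto[OF u2(6,7) b2[unfolded a2_def]])
      have "t1 k n - (a1 n)\<^sup>2 *\<^sub>R D k x + (t2 k n - (a2 n)\<^sup>2 *\<^sub>R D k x) = t1 k n + t2 k n - c k *\<^sub>R D k x" for n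
        unfolding c[of n, symmetric] scaleR_add_left by simp
      with tendsto_add[OF 1 2] have "(\<lambda>n. t1 k n + t2 k n - c k *\<^sub>R D k x) \<longlonglongrightarrow> 0" by simp
      then show ?thesis by (rule LIM_zero_cancel)
    qed
    then have "(\<lambda>n. \<Sum>k\<in>UNIV. t1 k n + t2 k n) \<longlonglongrightarrow> (\<Sum>k\<in>UNIV. c k *\<^sub>R D k x)"
      by (rule tendsto_sum)
    moreover have "(\<Sum>k\<in>UNIV. c k *\<^sub>R D k x) = (\<eta> x)\<^sup>2 *\<^sub>R D h x"
      by (simp add: c_def if_distrib[of "\<lambda>c. c *\<^sub>R _"] cong: if_cong)
    ultimately show ?thesis using True
      by (simp add: s1_def s2_def t1_def t2_def f_def dissipation_integrand_def sum.distrib scaleR_sum_right matrix_vector_mult_scaleR_right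
          cdot_scaleR_left cdot_scaleR_right power2_eq_square)
  qed (simp add: s1_def s2_def f_def)
  have f_meas: "f \<in> borel_measurable lebesgue"
    by (rule borel_measurable_LIMSEQ_metric[OF _ lim]) (intro borel_measurable_add meas1 meas2)
  have bd: "norm (s1 n x + s2 n x) \<le> w1 x + w2 x" for n x
    using norm_triangle_ineq[of "s1 n x" "s2 n x"] bd1[of n x] bd2[of n x] by linarith
  have dct: "(\<lambda>n. integral\<^sup>L lebesgue (\<lambda>x. s1 n x + s2 n x)) \<longlonglongrightarrow> integral\<^sup>L lebesgue f" "integrable lebesgue f"
    using f_meas borel_measurable_add[OF meas1 meas2] w lim bd
    by (auto intro!: integral_dominated_convergence[where w = "\<lambda>x. w1 x + w2 x"]
        integrable_dominated_convergence[where w = "\<lambda>x. w1 x + w2 x" and s = "\<lambda>n x. s1 n x + s2 n x"])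
  have "Re (integral\<^sup>L lebesgue f) \<ge> 0"
  proof (rule tendsto_lowerbound[OF tendsto_Re[OF dct(1)]])
    show "\<forall>\<^sub>F n in sequentially. 0 \<le> Re (integral\<^sup>L lebesgue (\<lambda>x. s1 n x + s2 n x))"
      using Re1 Re2 by (simp add: Bochner_Integration.integral_add[OF int])
  qed simp
  also have "Re (integral\<^sup>L lebesgue f) = integral\<^sup>L lebesgue (\<lambda>x. Re (f x))"
    using integral_Re[OF dct(2)] by simp
  also have "(\<lambda>x. Re (f x)) = (\<lambda>x. indicator \<Omega> x *\<^sub>R ((\<eta> x)\<^sup>2 * inner (A h x *v p) P))"
    by (simp add: f_def D_def Re_cdot fun_eq_iff)
  finally show ?thesis by (simp add: set_lebesgue_integral_def P_def)
qed

section \<open>Non-negativity of the form almost everywhere\<close>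

lemma set_integrable_form:
  fixes A :: "'n::finite \<Rightarrow> real ^ 'n \<Rightarrow> complex ^ 'm ^ 'm"
  assumes A: "\<And>h i j. L1_loc \<Omega> (\<lambda>x. A h x $ i $ j)" and K: "compact K" "K \<subseteq> \<Omega>"
  shows "set_integrable lebesgue K (\<lambda>x. inner (A h x *v p) q)"
proof -
  have "integrable lebesgue (\<lambda>x. \<Sum>i\<in>UNIV. \<Sum>j\<in>UNIV. (indicator K x *\<^sub>R (A h x $ i $ j)) * (p $ j * cnj (q $ i)))"
  proof (intro Bochner_Integration.integrable_sum integrable_mult_left)
    show "integrable lebesgue (\<lambda>x. indicator K x *\<^sub>R (A h x $ i $ j))" for i j
      using A[of h i j] K by (simp add: L1_loc_def set_integrable_def)
  qed
  from integrable_Re[OF this] show ?thesis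
    unfolding set_integrable_def
    by (rule Bochner_Integration.integrable_cong[THEN iffD1, rotated -1])
      (auto simp: indicator_def Re_cdot[symmetric] cdot_def matrix_vector_mult_def sum_distrib_right mult.assoc)
qed

text \<open>For each fixed \<open>h\<close>, \<open>v\<close> and \<open>p\<close> the inequality
  holds off a null set depending on them. Countably many pairs from a dense set and finitely many
  \<open>h\<close> leave a single null set; off it, a negative value at some pair with v \<noteq> 0
  would by continuity persist on an open set and hence at a pair of the dense set.\<close>

lemma AE_form_nonneg:
  fixes A :: "'n::finite \<Rightarrow> real ^ 'n \<Rightarrow> complex ^ 'm ^ 'm"
  assumes adm: "admissible \<phi>" and \<Omega>: "open \<Omega>" and A: "\<And>h i j. L1_loc \<Omega> (\<lambda>x. A h x $ i $ j)"
    and diss: "L_Phi_dissipative \<phi> \<Omega> A"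
  shows "AE x in lebesgue. x \<in> \<Omega> \<longrightarrow> (\<forall>h v p. v \<noteq> 0 \<longrightarrow> inner (A h x *v p) (dPhi \<phi> v p) \<ge> 0)"
proof -
  obtain D :: "((complex ^ 'm) \<times> (complex ^ 'm)) set"
    where D: "countable D" "\<And>X. open X \<Longrightarrow> X \<noteq> {} \<Longrightarrow> \<exists>d\<in>D. d \<in> X"
    by (rule countable_dense_setE) blast
  have "AE x in lebesgue. x \<in> \<Omega> \<longrightarrow> inner (A h x *v snd d) (dPhi \<phi> (fst d) (snd d)) \<ge> 0" if "fst d \<noteq> 0" for h d
  proof (rule AE_nonneg_of_compact_integrals[OF \<Omega> set_integrable_form[OF A]])
    fix K :: "(real ^ 'n) set" assume K: "compact K" "K \<subseteq> \<Omega>"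
    show "0 \<le> (LINT x:K|lebesgue. inner (A h x *v snd d) (dPhi \<phi> (fst d) (snd d)))"
      by (rule compact_integral_nonneg_of_C1_tests[OF \<Omega> set_integrable_form[OF A]
            dissipative_test_integral[OF adm \<Omega> A diss that] K])
  qed
  then have "AE x in lebesgue. \<forall>h\<in>UNIV. \<forall>d\<in>D. fst d \<noteq> 0 \<longrightarrow> x \<in> \<Omega> \<longrightarrow> inner (A h x *v snd d) (dPhi \<phi> (fst d) (snd d)) \<ge> 0"
    using D(1) by (intro AE_ball_countable' AE_impI) (simp_all add: countable_finite)
  then show ?thesis
  proof eventually_elim
    case (elim x)
    show ?case
    proof (intro impI allI, rule ccontr)
      fix h and v p :: "complex ^ 'm" assume x: "x \<in> \<Omega>" and v: "v \<noteq> 0" and "\<not> 0 \<le> inner (A h x *v p) (dPhi \<phi> v p)"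
      then have neg: "inner (A h x *v p) (dPhi \<phi> v p) < 0" by simp
      let ?S = "(- {0}) \<times> UNIV :: ((complex ^ 'm) \<times> (complex ^ 'm)) set"
      let ?g = "\<lambda>d. inner (A h x *v snd d) (dPhi \<phi> (fst d) (snd d))"
      have "linear (\<lambda>p. A h x *v p)"
        by (intro linearI) (simp_all add: matrix_vector_right_distrib matrix_vector_mult_scaleR_right)
      then have "continuous_on ?S (\<lambda>d. A h x *v snd d)"
        by (intro linear_continuous_on_compose[where g = "\<lambda>p. A h x *v p"] continuous_intros)
      moreover have "continuous_on ?S (\<lambda>d. dPhi \<phi> (fst d) (snd d))"
        using continuous_on_dPhi[OF adm] by (simp add: split_beta)
      ultimately have "continuous_on ?S ?g" by (intro continuous_on_inner)
      moreover have "open ?S" by (intro open_Times) auto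
      ultimately have "open (?S \<inter> ?g -` {..<0})" by (rule continuous_open_preimage) auto
      moreover have "(v, p) \<in> ?S \<inter> ?g -` {..<0}" using v neg by simp
      ultimately obtain d where d: "d \<in> D" "d \<in> ?S \<inter> ?g -` {..<0}" using D(2) by blast
      then have "fst d \<noteq> 0" "?g d < 0" by (auto simp: mem_Times_iff)
      with elim[rule_format, OF UNIV_I d(1) _ x, of h] show False by simp
    qed
  qed
qed

text \<open>For fixed \<open>l\<close> and \<omega> the form is a polynomial in \<open>L\<close>, so
  its sign survives the limit of \<open>Lambda_at\<close>.\<close>

lemma form_nonneg_Lambda_inf:
  fixes B :: "complex ^ 'm ^ 'm"
  assumes adm: "admissible \<phi>" and form_nonneg: "\<And>s. s > 0 \<Longrightarrow> form_nonneg B (Lambda_at \<phi> s)"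
  shows "form_nonneg B (Lambda_inf \<phi>)"
  unfolding form_nonneg_def
proof (intro allI impI)
  fix l \<omega> :: "complex ^ 'm" assume \<omega>: "norm \<omega> = 1"
  define g where "g L = Re (cdot (B *v l) l) - L\<^sup>2 * Re (cdot (B *v \<omega>) \<omega>) * (Re (cdot l \<omega>))\<^sup>2
        + L * Re (cdot (B *v \<omega>) l - cdot (B *v l) \<omega>) * Re (cdot l \<omega>)" for L
  have "((\<lambda>s. g (Lambda_at \<phi> s)) \<longlongrightarrow> g (Lambda_inf \<phi>)) at_top"
    unfolding g_def by (intro tendsto_intros Lambda_at_tendsto[OF adm])
  moreover have "\<forall>\<^sub>F s in at_top. 0 \<le> g (Lambda_at \<phi> s)"
    using eventually_gt_at_top[of 0] by eventually_elim (use form_nonneg \<omega> in \<open>simp add: form_nonneg_def g_def\<close>)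
  ultimately have "0 \<le> g (Lambda_inf \<phi>)" by (rule tendsto_lowerbound) simp
  then show "0 \<le> Re (cdot (B *v l) l) - (Lambda_inf \<phi>)\<^sup>2 * Re (cdot (B *v \<omega>) \<omega>) * (Re (cdot l \<omega>))\<^sup>2
        + Lambda_inf \<phi> * Re (cdot (B *v \<omega>) l - cdot (B *v l) \<omega>) * Re (cdot l \<omega>)"
    by (simp only: g_def)
qed

text \<open>At a zero of \<open>u\<close> the derivative of \<phi>(|u|) u is a non-negative multiple
  of that of \<open>u\<close> unless the latter vanishes, and \<open>form_nonneg_diag\<close>
  suffices. Elsewhere \<open>Lambda_at\<close> lies between 0 and \<open>Lambda_inf\<close>, so the
  inequality at \<open>Lambda_inf\<close> passes to it.\<close>

lemma form_nonneg_integrand: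
  fixes B :: "complex ^ 'm ^ 'm" and u :: "real ^ 'n \<Rightarrow> complex ^ 'm"
  assumes adm: "admissible \<phi>" and form_nonneg: "form_nonneg B (Lambda_inf \<phi>)"
    and u: "u differentiable (at x)" and V: "(\<lambda>x. \<phi> (norm (u x)) *\<^sub>R u x) differentiable (at x)"
  shows "Re (cdot (B *v pderiv_dir h u x) (pderiv_dir h (\<lambda>x. \<phi> (norm (u x)) *\<^sub>R u x) x)) \<ge> 0"
proof (cases "u x = 0")
  case True
  show ?thesis
  proof (cases "pderiv_dir h u x = 0")
    case False
    obtain c where "c \<ge> 0" "pderiv_dir h (\<lambda>x. \<phi> (norm (u x)) *\<^sub>R u x) x = c *\<^sub>R pderiv_dir h u x"
      by (rule pderiv_dir_Phi_zero[OF adm u V True False])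
    then show ?thesis using form_nonneg_diag[OF form_nonneg, of "pderiv_dir h u x"] by (simp add: Re_cdot)
  qed (simp add: cdot_def)
next
  case False
  define s where "s = norm (u x)"
  define \<omega> where "\<omega> = u x /\<^sub>R s"
  have s: "s > 0" "norm \<omega> = 1" "u x = s *\<^sub>R \<omega>" using False by (auto simp: s_def \<omega>_def)
  obtain \<theta> where "0 \<le> \<theta>" "\<theta> \<le> 1" "Lambda_at \<phi> s = \<theta> * Lambda_inf \<phi>" by (rule Lambda_at_between[OF adm s(1)])
  then have "form_nonneg B (Lambda_at \<phi> s)" using form_nonneg_scale[OF form_nonneg] by simp
  then have "inner (B *v pderiv_dir h u x) (dPhi \<phi> (u x) (pderiv_dir h u x)) \<ge> 0"
    using s(2) unfolding form_nonneg_Lambda_at_iff[OF adm s(1)] s(3) by blast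
  then show ?thesis
    by (simp add: Re_cdot pderiv_dir_compose[OF u has_derivative_dPhi[OF adm False]])
qed

section \<open>The characterisation\<close>

theorem theorem5:
  fixes \<phi> :: "real \<Rightarrow> real"
    and \<Omega> :: "(real ^ 'n) set"
    and A :: "'n \<Rightarrow> real ^ 'n \<Rightarrow> complex ^ 'm ^ 'm"
  assumes "admissible \<phi>"
    and "open \<Omega>" "connected \<Omega>" "\<Omega> \<noteq> {}"
    and "\<And>h i j. L1_loc \<Omega> (\<lambda>x. A h x $ i $ j)"
  shows "L_Phi_dissipative \<phi> \<Omega> A \<longleftrightarrow>
    (AE x in lebesgue. x \<in> \<Omega> \<longrightarrow>
      (\<forall>(l::complex ^ 'm) (\<omega>::complex ^ 'm) h. norm \<omega> = 1 \<longrightarrow>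
        Re (cdot (A h x *v l) l)
        - (Lambda_inf \<phi>)\<^sup>2 * Re (cdot (A h x *v \<omega>) \<omega>) * (Re (cdot l \<omega>))\<^sup>2
        + Lambda_inf \<phi> * Re (cdot (A h x *v \<omega>) l - cdot (A h x *v l) \<omega>) * Re (cdot l \<omega>)
        \<ge> 0))"
    (is "?lhs \<longleftrightarrow> ?rhs")
proof -
  have rhs: "?rhs \<longleftrightarrow> (AE x in lebesgue. x \<in> \<Omega> \<longrightarrow> (\<forall>h. form_nonneg (A h x) (Lambda_inf \<phi>)))"
    unfolding form_nonneg_def by (intro arg_cong[where f = "\<lambda>P. AE x in lebesgue. P x"] ext) blast
  show ?thesis
    unfolding rhs
  proof
    assume "?lhs"
    from AE_form_nonneg[OF assms(1,2,5) this]
    show "AE x in lebesgue. x \<in> \<Omega> \<longrightarrow> (\<forall>h. form_nonneg (A h x) (Lambda_inf \<phi>))"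
    proof eventually_elim
      case (elim x)
      show ?case
      proof (intro impI allI form_nonneg_Lambda_inf[OF assms(1)])
        fix h and s :: real assume "x \<in> \<Omega>" and s: "s > 0"
        with elim have *: "inner (A h x *v p) (dPhi \<phi> v p) \<ge> 0" if "v \<noteq> 0" for v p using that by blast
        show "form_nonneg (A h x) (Lambda_at \<phi> s)"
          unfolding form_nonneg_Lambda_at_iff[OF assms(1) s] using s by (auto intro!: *)
      qed
    qed
  next
    assume ae: "AE x in lebesgue. x \<in> \<Omega> \<longrightarrow> (\<forall>h. form_nonneg (A h x) (Lambda_inf \<phi>))"
    show ?lhs
      unfolding L_Phi_dissipative_def
    proof (intro allI impI, elim conjE)
      fix u :: "real ^ 'n \<Rightarrow> complex ^ 'm"
      assume u: "u \<in> C10 \<Omega>" and V: "(\<lambda>x. \<phi> (norm (u x)) *\<^sub>R u x) \<in> C10 \<Omega>"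
      define F where "F x = indicator \<Omega> x *\<^sub>R dissipation_integrand \<phi> A u x" for x
      have "Re (integral\<^sup>L lebesgue F) \<ge> 0"
      \<comment> \<open>The integral of a non-integrable function is 0 by convention, so this case
        distinction takes the place of a proof that \<open>F\<close> is integrable.\<close>
      proof (cases "integrable lebesgue F")
        case True
        have "AE x in lebesgue. 0 \<le> Re (F x)"
          using ae
        proof eventually_elim
          case (elim x)
          show ?case
          proof (cases "x \<in> \<Omega>")
            case True
            then have "0 \<le> Re (cdot (A h x *v pderiv_dir h u x) (pderiv_dir h (\<lambda>x. \<phi> (norm (u x)) *\<^sub>R u x) x))" for h
              using elim u V by (intro form_nonneg_integrand assms(1)) (auto simp: C10_def)
            then show ?thesis using True by (simp add: F_def dissipation_integrand_def sum_nonneg)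
          qed (simp add: F_def)
        qed
        then have "0 \<le> integral\<^sup>L lebesgue (\<lambda>x. Re (F x))" by (rule integral_nonneg_AE)
        then show ?thesis using integral_Re[OF True] by simp
      qed (simp add: not_integrable_integral_eq)
      then show "0 \<le> Re (LINT x:\<Omega>|lebesgue. (\<Sum>h\<in>UNIV. cdot (A h x *v pderiv_dir h u x)
                   (pderiv_dir h (\<lambda>y. \<phi> (norm (u y)) *\<^sub>R u y) x)))"
        by (simp add: F_def[abs_def] set_lebesgue_integral_def dissipation_integrand_def)
    qed
  qed
qed

end
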